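(* Fix a combinatorial problem $\mathcal{P}$, i.e. a class of feasible sets $\mathcal{X}\subseteq\{0,1\}^n$, and consider OWA $\mathcal{P}$ with nonincreasing weights: given $\mathcal{X}$, nonnegative cost vectors $\pmb{c}_1,\dots,\pmb{c}_K\in\mathbb{R}^n_{\ge0}$ and weights $\pmb{w}$ with $w_k\in[0,1]$, $\sum_k w_k=1$, $w_1\ge\dots\ge w_K$, minimize $\mathrm{OWA}_{\pmb{w}}(\pmb{c}_1^T\pmb{x},\dots,\pmb{c}_K^T\pmb{x})$ over $\pmb{x}\in\mathcal{X}$. Suppose that for every constant number $K$ of objectives, OWA $\mathcal{P}$ has a polynomial-time 2-approximation algorithm. Then for every constant $\epsilon>0$, OWA $\mathcal{P}$ (with $K$ part of the input) has a polynomial-time $\epsilon K$-approximation algorithm, i.e. an algorithm returning $\pmb{x}\in\mathcal{X}$ whose objective value is at most $\epsilon K$ times the optimum.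
   Context: For a real vector $\pmb{b}=(b_1,\dots,b_K)$ and weights $\pmb{w}$ (nonnegative, summing to 1), $\mathrm{OWA}_{\pmb{w}}(\pmb{b})=\sum_{k=1}^K w_k b_{\tau(k)}$, where $\tau$ is a permutation of $\{1,\dots,K\}$ with $b_{\tau(1)}\ge\dots\ge b_{\tau(K)}$.
   Formalization: The ratio proved is max(2, εK), since εK is impossible when εK<1 and would beat the assumed factor 2 when εK<2; costs and weights are rationals given in binary, as polynomial time needs finitely encoded input. *)

theory Defs
  imports
    Complex_Main
    "HOL-Library.Log_Nat"
    "HOL-Computational_Algebra.Polynomial"
    "HOL-Combinatorics.Permutations"
begin

section \<open>Polynomial-time computation\<close>

text \<open>
  The machine model is a while language on S-expressions whose atoms are natural numbers in
  binary, under the logarithmic cost criterion. Evaluating an expression charges, for every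
  node, the bit size of the value of that node; so every primitive operation is charged at least
  the size of its operands and of its result, and as all the primitives are polynomial-time
  computable in the bit model, polynomial cost here is the same as polynomial time on a Turing
  machine. The atom 0 serves as the empty list and as the truth value false.
\<close>

datatype val = Num nat | Node val val

fun bits :: "val \<Rightarrow> nat" where
  "bits (Num n) = 1 + floorlog 2 n"
| "bits (Node u v) = 1 + bits u + bits v"

datatype unop = Fst | Snd | IsNode
datatype binop = MkNode | Plus | Minus | Times | Div | Less

fun num :: "val \<Rightarrow> nat" where
  "num (Num n) = n"
| "num (Node u v) = 0"

fun un :: "unop \<Rightarrow> val \<Rightarrow> val" where
  "un Fst (Node u v) = u"
| "un Snd (Node u v) = v"
| "un IsNode (Node u v) = Num 1"
| "un _ (Num n) = Num 0"

fun bin :: "binop \<Rightarrow> val \<Rightarrow> val \<Rightarrow> val" where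
  "bin MkNode u v = Node u v"
| "bin Plus u v = Num (num u + num v)"
| "bin Minus u v = Num (num u - num v)"
| "bin Times u v = Num (num u * num v)"
| "bin Div u v = Num (num u div num v)"
| "bin Less u v = Num (if num u < num v then 1 else 0)"

type_synonym state = "nat \<Rightarrow> val"

datatype expr = Const val | Var nat | Op1 unop expr | Op2 binop expr expr

fun eval :: "expr \<Rightarrow> state \<Rightarrow> val" where
  "eval (Const v) s = v"
| "eval (Var x) s = s x"
| "eval (Op1 f e) s = un f (eval e s)"
| "eval (Op2 f e e') s = bin f (eval e s) (eval e' s)"

fun cost :: "expr \<Rightarrow> state \<Rightarrow> nat" where
  "cost (Const v) s = bits v"
| "cost (Var x) s = bits (s x)"
| "cost (Op1 f e) s = cost e s + bits (eval (Op1 f e) s)"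
| "cost (Op2 f e e') s = cost e s + cost e' s + bits (eval (Op2 f e e') s)"

datatype com = Assign nat expr | Seq com com | Cond expr com com | While expr com

text \<open>\<open>exec c s t s'\<close>: started in state \<open>s\<close>, program \<open>c\<close> halts in state \<open>s'\<close> after time \<open>t\<close>.\<close>

inductive exec :: "com \<Rightarrow> state \<Rightarrow> nat \<Rightarrow> state \<Rightarrow> bool" where
  Assign: "exec (Assign x e) s (cost e s) (s(x := eval e s))"
| Seq: "exec c s t s' \<Longrightarrow> exec c' s' t' s'' \<Longrightarrow> exec (Seq c c') s (t + t') s''"
| CondTrue: "eval e s \<noteq> Num 0 \<Longrightarrow> exec c s t s' \<Longrightarrow> exec (Cond e c c') s (cost e s + t) s'"
| CondFalse: "eval e s = Num 0 \<Longrightarrow> exec c' s t s' \<Longrightarrow> exec (Cond e c c') s (cost e s + t) s'"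
| WhileFalse: "eval e s = Num 0 \<Longrightarrow> exec (While e c) s (cost e s) s"
| WhileTrue: "eval e s \<noteq> Num 0 \<Longrightarrow> exec c s t s' \<Longrightarrow> exec (While e c) s' t' s'' \<Longrightarrow>
    exec (While e c) s (cost e s + t + t') s''"

text \<open>Input and output are passed in variable 0; all other variables are initially 0.\<close>

definition computes :: "com \<Rightarrow> val \<Rightarrow> nat \<Rightarrow> val \<Rightarrow> bool" where
  "computes c v t v' \<longleftrightarrow> (\<exists>s. exec c ((\<lambda>_. Num 0)(0 := v)) t s \<and> s 0 = v')"

fun enc_list :: "('a \<Rightarrow> val) \<Rightarrow> 'a list \<Rightarrow> val" where
  "enc_list f [] = Num 0"
| "enc_list f (x # xs) = Node (f x) (enc_list f xs)"


section \<open>Ordered weighted averages\<close>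

definition sorting_perm :: "real list \<Rightarrow> (nat \<Rightarrow> nat) \<Rightarrow> bool" where
  "sorting_perm b \<tau> \<longleftrightarrow>
     \<tau> permutes {..<length b} \<and> (\<forall>i j. i \<le> j \<and> j < length b \<longrightarrow> b ! \<tau> i \<ge> b ! \<tau> j)"

definition owa :: "real list \<Rightarrow> real list \<Rightarrow> real" where
  "owa w b = (let \<tau> = (SOME \<tau>. sorting_perm b \<tau>) in \<Sum>k<length b. w ! k * b ! \<tau> k)"

lemma sorting_perm_exists: "\<exists>\<tau>. sorting_perm b \<tau>"
proof -
  have "mset (rev (sort b)) = mset b" by simp
  then obtain \<tau> where p: "\<tau> permutes {..<length b}" and eq: "permute_list \<tau> b = rev (sort b)"
    by (metis mset_eq_permutation)
  have "b ! \<tau> j \<le> b ! \<tau> i" if "i \<le> j" "j < length b" for i j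
  proof -
    have "b ! \<tau> k = rev (sort b) ! k" if "k < length b" for k
      using permute_list_nth[OF p that] eq by simp
    moreover have "rev (sort b) ! j \<le> rev (sort b) ! i"
      using that by (simp add: rev_nth sorted_nth_mono)
    ultimately show ?thesis using that by simp
  qed
  with p show ?thesis unfolding sorting_perm_def by blast
qed

lemma owa_eq:
  assumes "sorting_perm b \<tau>"
  shows "owa w b = (\<Sum>k<length b. w ! k * b ! \<tau> k)"
proof -
  have *: "permute_list \<sigma> b = rev (sort b)" if "sorting_perm b \<sigma>" for \<sigma>
  proof -
    have p: "\<sigma> permutes {..<length b}" using that by (simp add: sorting_perm_def)
    have m: "b ! \<sigma> (length b - Suc i) \<le> b ! \<sigma> (length b - Suc j)" if "i \<le> j" "j < length b" for i j
    proof -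
      have "length b - Suc j \<le> length b - Suc i" "length b - Suc i < length b"
        using that by auto
      then show ?thesis using \<open>sorting_perm b \<sigma>\<close> unfolding sorting_perm_def by blast
    qed
    have "sorted (rev (permute_list \<sigma> b))"
      unfolding sorted_iff_nth_mono using m permute_list_nth[OF p] by (simp add: rev_nth)
    moreover have "mset (rev (permute_list \<sigma> b)) = mset b"
      using p by simp
    ultimately have "sort b = rev (permute_list \<sigma> b)"
      by (metis properties_for_sort)
    then show ?thesis by simp
  qed
  have **: "b ! \<sigma> k = rev (sort b) ! k" if "sorting_perm b \<sigma>" "k < length b" for \<sigma> k
    using *[OF that(1)] permute_list_nth[of \<sigma> b k] that by (simp add: sorting_perm_def)
  have "sorting_perm b (SOME \<tau>. sorting_perm b \<tau>)"
    using sorting_perm_exists by (rule someI_ex)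
  then show ?thesis
    unfolding owa_def Let_def using ** assms by (intro sum.cong) auto
qed


section \<open>The problem OWA P\<close>

text \<open>
  A combinatorial problem is given by a partial map from instance descriptions (for example
  encoded graphs) to a dimension \<open>n\<close> and a feasible set contained in \<open>{0,1}\<^sup>n\<close>.
\<close>

type_synonym problem = "val \<Rightarrow> (nat \<times> nat list set) option"

definition combinatorial_problem :: "problem \<Rightarrow> bool" where
  "combinatorial_problem P \<longleftrightarrow>
     (\<forall>d n X. P d = Some (n, X) \<longrightarrow> X \<subseteq> {x. length x = n \<and> set x \<subseteq> {0, 1}})"

text \<open>
  The numerical data of an instance are nonnegative rationals, given by a numerator and a positive
  denominator in binary, not necessarily coprime.
\<close>

type_synonym frac = "nat \<times> nat"

definition frac_val :: "frac \<Rightarrow> real" where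
  "frac_val r = real (fst r) / real (snd r)"

definition is_frac :: "frac \<Rightarrow> bool" where
  "is_frac r \<longleftrightarrow> snd r > 0"

definition cost_vectors :: "nat \<Rightarrow> frac list list \<Rightarrow> bool" where
  "cost_vectors n C \<longleftrightarrow> (\<forall>c\<in>set C. length c = n \<and> (\<forall>r\<in>set c. is_frac r))"

definition nonincreasing_weights :: "nat \<Rightarrow> frac list \<Rightarrow> bool" where
  "nonincreasing_weights K w \<longleftrightarrow>
     length w = K \<and> (\<forall>r\<in>set w. is_frac r \<and> frac_val r \<in> {0..1}) \<and>
     (\<Sum>k<K. frac_val (w ! k)) = 1 \<and>
     (\<forall>i j. i \<le> j \<and> j < K \<longrightarrow> frac_val (w ! i) \<ge> frac_val (w ! j))"

definition linear_cost :: "frac list \<Rightarrow> nat list \<Rightarrow> real" where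
  "linear_cost c x = (\<Sum>i<length x. frac_val (c ! i) * real (x ! i))"

definition objective :: "frac list list \<Rightarrow> frac list \<Rightarrow> nat list \<Rightarrow> real" where
  "objective C w x = owa (map frac_val w) (map (\<lambda>c. linear_cost c x) C)"

definition enc_frac :: "frac \<Rightarrow> val" where
  "enc_frac r = Node (Num (fst r)) (Num (snd r))"

definition enc_instance :: "val \<Rightarrow> frac list list \<Rightarrow> frac list \<Rightarrow> val" where
  "enc_instance d C w =
     Node d (Node (enc_list (enc_list enc_frac) C) (enc_list enc_frac w))"

text \<open>
  \<open>owa_approximable P Ks \<rho>\<close>: some polynomial-time algorithm for OWA P, on the instances whose number
  \<open>K\<close> of objectives lies in \<open>Ks\<close>, returns a feasible solution of value at most \<open>\<rho> K\<close> times the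
  optimum. For an empty feasible set only the time bound is required.
\<close>

definition owa_approximable :: "problem \<Rightarrow> nat set \<Rightarrow> (nat \<Rightarrow> real) \<Rightarrow> bool" where
  "owa_approximable P Ks \<rho> \<longleftrightarrow>
     (\<exists>(alg :: com) (p :: nat poly). \<forall>d n X K C w.
        P d = Some (n, X) \<and> K \<in> Ks \<and> length C = K \<and> cost_vectors n C \<and>
        nonincreasing_weights K w \<longrightarrow>
        (\<exists>t v. computes alg (enc_instance d C w) t v \<and>
           t \<le> poly p (bits (enc_instance d C w)) \<and>
           (X \<noteq> {} \<longrightarrow>
             (\<exists>x\<in>X. v = enc_list Num x \<and>
                objective C w x \<le> \<rho> K * (MIN y\<in>X. objective C w y)))))"

text \<open>
  A solution of value at most \<open>\<epsilon> K\<close> times a positive optimum cannot exist for \<open>K < 1 / \<epsilon>\<close>, so the ratio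
  \<open>\<epsilon> K\<close> only makes sense for \<open>K\<close> large compared with \<open>1 / \<epsilon>\<close>:
\<close>

lemma no_epsK_approximation_for_small_K:
  "\<exists>P. combinatorial_problem P \<and> (\<forall>K. owa_approximable P {K} (\<lambda>_. 2)) \<and>
       \<not> (\<forall>\<epsilon>>0. owa_approximable P {1..} (\<lambda>K. \<epsilon> * real K))"
proof -
  define P :: problem where "P = (\<lambda>_. Some (1, {[1]}))"
  have obj_nonneg: "objective C w x \<ge> 0" if "length w = length C" for C w x
  proof -
    obtain \<tau> where t: "sorting_perm (map (\<lambda>c. linear_cost c x) C) \<tau>"
      using sorting_perm_exists by blast
    have "\<tau> k < length C" if "k < length C" for k
      using t that permutes_in_image[of \<tau> "{..<length C}" k] by (simp add: sorting_perm_def)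
    then show ?thesis
      unfolding objective_def owa_eq[OF t] using that
      by (intro sum_nonneg) (auto simp: linear_cost_def frac_val_def intro!: sum_nonneg mult_nonneg_nonneg divide_nonneg_nonneg)
  qed
  have a: "owa_approximable P {K} (\<lambda>_. 2)" for K
    unfolding owa_approximable_def
  proof (intro exI allI impI)
    fix d n X K' C w
    assume "P d = Some (n, X) \<and> K' \<in> {K} \<and> length C = K' \<and> cost_vectors n C \<and>
      nonincreasing_weights K' w"
    then have X: "X = {[1]}" and l: "length w = length C"
      by (auto simp: P_def nonincreasing_weights_def)
    let ?v = "Node (Num 1) (Num 0)"
    show "computes (Assign 0 (Const ?v)) (enc_instance d C w) (bits ?v) ?v \<and>
      bits ?v \<le> poly [:bits ?v:] (bits (enc_instance d C w)) \<and>
      (X \<noteq> {} \<longrightarrow> (\<exists>x\<in>X. ?v = enc_list Num x \<and>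
         objective C w x \<le> 2 * (MIN y\<in>X. objective C w y)))"
      using exec.Assign[of 0 "Const ?v" "(\<lambda>_. Num 0)(0 := enc_instance d C w)"]
        obj_nonneg[OF l, of "[1]"]
      by (auto simp: computes_def X)
  qed
  have b: "\<not> owa_approximable P {1..} (\<lambda>K. 1/2 * real K)"
  proof
    assume "owa_approximable P {1..} (\<lambda>K. 1/2 * real K)"
    moreover have "P (Num 0) = Some (1, {[1]}) \<and> (1::nat) \<in> {1..} \<and> length [[(1,1)::frac]] = 1 \<and>
      cost_vectors 1 [[(1,1)]] \<and> nonincreasing_weights 1 [(1,1)]"
      by (simp add: P_def cost_vectors_def nonincreasing_weights_def is_frac_def frac_val_def)
    ultimately have "objective [[(1,1)]] [(1,1)] [1] \<le>
        1/2 * real 1 * (MIN y\<in>{[1]}. objective [[(1,1)]] [(1,1)] y)"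
      unfolding owa_approximable_def by blast
    moreover have "objective [[(1,1)]] [(1,1)] [1] = 1"
    proof -
      have "sorting_perm [1] id" by (simp add: sorting_perm_def permutes_id)
      from owa_eq[OF this, of "[1]"] show ?thesis
        by (simp add: objective_def linear_cost_def frac_val_def)
    qed
    ultimately show False by simp
  qed
  have "combinatorial_problem P" by (auto simp: combinatorial_problem_def P_def)
  with a b show ?thesis by (intro exI[of _ P]) (auto intro!: exI[of _ "1/2"])
qed

end

theory Submission
  imports Defs
begin

text \<open>
  Fix a constant \<open>L \<ge> 8 / \<epsilon>\<close>, split the \<open>K\<close> objectives into the residue classes of their indices modulo
  \<open>L\<close>, and add up the cost vectors and the weights in each class. This is an instance with \<open>L\<close>
  objectives whose weights again sum to 1 and are nonincreasing, so the algorithm for \<open>L\<close>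
  objectives applies to it.

  Sort the objective values \<open>f\<close> of a solution and its aggregated values \<open>a\<close> decreasingly. The \<open>k\<close>
  largest entries of \<open>f\<close> lie in at most \<open>k\<close> classes, so the prefix sums of \<open>f\<close> are at most those of \<open>a\<close>.
  A class has at most \<open>m = K div L + 1\<close> members, so the prefix sums of \<open>a\<close> are at most \<open>m\<close> times those of
  \<open>f\<close>; reading \<open>a\<close> periodically, to account for the weights of index at least \<open>L\<close>, costs another
  factor of at most 2. Summation by parts turns this into \<open>OWA f \<le> OWA a \<le> 2 m OWA f\<close>, and into
  \<open>OWA f = OWA a\<close> if \<open>K \<le> L\<close>. The resulting ratio is 2 for \<open>K \<le> L\<close> and \<open>4 m \<le> 8 K / L\<close> otherwise.

  The aggregation is carried out by a program that keeps a queue of \<open>L\<close> partial sums. Fractions are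
  added without reduction, which is harmless because their lengths only add up.
\<close>

section \<open>Ordered weighted averages of aggregated objectives\<close>

text \<open>Summation by parts: the difference of the two sums is a combination of the prefix-sum
  differences with coefficients \<open>u i - u (Suc i)\<close> and a last coefficient
  \<open>u n\<close>, all of them nonnegative.\<close>

lemma abel_le:
  fixes u x y :: "nat \<Rightarrow> real"
  assumes u: "antimono u" "\<And>i. 0 \<le> u i"
    and le: "\<And>k. k \<le> n \<Longrightarrow> sum x {..<k} \<le> sum y {..<k}"
  shows "(\<Sum>i<n. u i * x i) \<le> (\<Sum>i<n. u i * y i)"
proof -
  \<comment> \<open>Keeping the boundary term makes the claim inductive: passing from
    \<open>u n\<close> to the smaller \<open>u (Suc n)\<close> only lowers it, since the prefix-sum
    difference is nonnegative.\<close>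
  have "u n * (sum y {..<n} - sum x {..<n}) \<le> (\<Sum>i<n. u i * y i) - (\<Sum>i<n. u i * x i)"
    using le
  proof (induction n)
    case (Suc n)
    have "u (Suc n) * (sum y {..<Suc n} - sum x {..<Suc n}) \<le> u n * (sum y {..<Suc n} - sum x {..<Suc n})"
      using Suc.prems[of "Suc n"] u(1) by (intro mult_right_mono) (auto simp: antimono_def)
    moreover have "u n * (sum y {..<n} - sum x {..<n}) \<le> (\<Sum>i<n. u i * y i) - (\<Sum>i<n. u i * x i)"
      by (rule Suc.IH) (simp add: Suc.prems)
    ultimately show ?case by (simp add: algebra_simps)
  qed simp
  moreover have "0 \<le> u n * (sum y {..<n} - sum x {..<n})"
    using le[of n] u(2) by (intro mult_nonneg_nonneg) auto
  ultimately show ?thesis by linarith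
qed

text \<open>Exchange argument with \<open>x k\<close> as threshold: an index of \<open>J\<close>
  outside \<open>{..<k}\<close> contributes at most \<open>x k\<close>, an index below
  \<open>k\<close> missing from \<open>J\<close> at least \<open>x k\<close>, and there are at least
  as many of the latter.\<close>

lemma sum_le_prefix_sum:
  fixes x :: "nat \<Rightarrow> real"
  assumes x: "antimono x" "\<And>i. 0 \<le> x i" and J: "finite J" "card J \<le> k"
  shows "sum x J \<le> sum x {..<k}"
proof -
  have "card (J - {..<k}) + card (J \<inter> {..<k}) = card J"
    using card_Diff_subset_Int[of J "{..<k}"] card_mono[of J "J \<inter> {..<k}"] J by auto
  moreover have "card ({..<k} - J) + card (J \<inter> {..<k}) = k"
    using card_Diff_subset_Int[of "{..<k}" J] card_mono[of "{..<k}" "J \<inter> {..<k}"]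
    by (auto simp: Int_commute)
  ultimately have c: "real (card (J - {..<k})) \<le> real (card ({..<k} - J))" using J by simp
  have "sum x (J - {..<k}) \<le> real (card (J - {..<k})) * x k"
    using x(1) by (intro sum_bounded_above) (auto simp: antimono_def)
  also have "\<dots> \<le> real (card ({..<k} - J)) * x k" using c x(2) by (intro mult_right_mono)
  also have "\<dots> \<le> sum x ({..<k} - J)"
    using x(1) by (intro sum_bounded_below) (auto simp: antimono_def)
  finally have "sum x (J - {..<k}) \<le> sum x ({..<k} - J)" .
  moreover have "sum x J = sum x (J \<inter> {..<k}) + sum x (J - {..<k})"
    using J by (simp add: sum.Int_Diff)
  moreover have "sum x {..<k} = sum x (J \<inter> {..<k}) + sum x ({..<k} - J)"
    using sum.Int_Diff[of "{..<k}" x J] by (simp add: Int_commute)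
  ultimately show ?thesis by simp
qed

text \<open>The average of the first entries of a nonincreasing sequence does not grow as more
  entries are taken; it is multiplied out so that no division by \<open>k\<close> occurs.\<close>

lemma prefix_sum_scale:
  fixes x :: "nat \<Rightarrow> real"
  assumes "antimono x"
  shows "real k * sum x {..<k + l} \<le> real (k + l) * sum x {..<k}"
proof -
  have a: "sum x {..<k + l} = sum x {..<k} + sum x {k..<k + l}"
    using sum.atLeastLessThan_concat[of 0 k "k + l" x] by (simp add: atLeast0LessThan)
  have "sum x {k..<k + l} \<le> real (card {k..<k + l}) * x k"
    using assms by (intro sum_bounded_above) (auto simp: antimono_def)
  then have "real k * sum x {k..<k + l} \<le> real k * (real l * x k)"
    by (intro mult_left_mono) auto
  also have "\<dots> = real l * (real k * x k)" by simp
  also have "real k * x k \<le> sum x {..<k}"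
    using sum_bounded_below[of "{..<k}" "x k" x] assms by (auto simp: antimono_def)
  finally have "real k * sum x {k..<k + l} \<le> real l * sum x {..<k}" by (simp add: mult_left_mono)
  then show ?thesis by (simp add: a algebra_simps)
qed

text \<open>Padding with 0 allows prefix sums of any length; for nonnegative entries the padded
  sequence is still nonincreasing.\<close>

definition decreasing :: "real list \<Rightarrow> nat \<Rightarrow> real" where
  "decreasing b i = (if i < length b then b ! (SOME \<tau>. sorting_perm b \<tau>) i else 0)"

lemma owa_eq_decreasing: "owa w b = (\<Sum>k<length b. w ! k * decreasing b k)"
  unfolding owa_def Let_def by (rule sum.cong) (simp_all add: decreasing_def)

section \<open>Decreasing rearrangement of a nonnegative list\<close>

context
  fixes b :: "real list"
  assumes nonneg_set: "\<forall>r\<in>set b. 0 \<le> r"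
begin

private lemma nonneg: "i < length b \<Longrightarrow> 0 \<le> b ! i"
  using nonneg_set by simp

qualified definition "\<tau> = (SOME \<tau>. sorting_perm b \<tau>)"

private lemma sorting: "sorting_perm b \<tau>"
  unfolding \<tau>_def using sorting_perm_exists by (rule someI_ex)

private lemma perm: "\<tau> permutes {..<length b}"
  using sorting by (simp add: sorting_perm_def)

private lemma in_range: "\<tau> i < length b \<longleftrightarrow> i < length b"
  using permutes_in_image[OF perm, of i] by simp

private lemma decreasing_eq: "decreasing b i = (if i < length b then b ! \<tau> i else 0)"
  by (simp add: decreasing_def \<tau>_def)

lemma decreasing_nonneg: "0 \<le> decreasing b i"
  by (simp add: decreasing_eq nonneg in_range)

lemma antimono_decreasing: "antimono (decreasing b)"
proof (rule antimonoI)
  fix i j :: nat assume "i \<le> j"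
  then show "decreasing b j \<le> decreasing b i"
    using sorting nonneg[of "\<tau> i"] in_range[of i] by (auto simp: decreasing_eq sorting_perm_def)
qed

private lemma sum_decreasing:
  assumes "J \<subseteq> {..<length b}"
  shows "sum (decreasing b) J = (\<Sum>i\<in>\<tau> ` J. b ! i)"
  using assms permutes_inj_on[OF perm, of J]
  by (auto simp: sum.reindex decreasing_eq intro!: sum.cong)

lemma sum_le_decreasing:
  assumes S: "S \<subseteq> {..<length b}" "card S \<le> k"
  shows "(\<Sum>i\<in>S. b ! i) \<le> sum (decreasing b) {..<k}"
proof -
  define J where "J = inv \<tau> ` S"
  have J: "\<tau> ` J = S"
    unfolding J_def by (rule image_f_inv_f[OF permutes_surj[OF perm]])
  have "finite S" using S(1) by (rule finite_subset) simp
  then have "finite J" "card J \<le> k"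
    unfolding J_def using card_image_le[of S "inv \<tau>"] S(2) by simp_all
  moreover have "J \<subseteq> {..<length b}"
  proof
    fix i assume "i \<in> J"
    then have "\<tau> i < length b" using J S(1) by blast
    then show "i \<in> {..<length b}" by (simp add: in_range)
  qed
  ultimately show ?thesis
    using sum_le_prefix_sum[OF antimono_decreasing decreasing_nonneg, of J k] sum_decreasing[of J] J
    by simp
qed

text \<open>Together with \<open>sum_le_decreasing\<close> this makes the prefix sum of length
  \<open>k\<close> the maximum of all sums over at most \<open>k\<close> positions, so the
  comparisons below can avoid sorting permutations.\<close>

lemma sum_decreasing_attained:
  "\<exists>S\<subseteq>{..<length b}. card S \<le> k \<and> sum (decreasing b) {..<k} = (\<Sum>i\<in>S. b ! i)"
proof (intro exI[of _ "\<tau> ` {..<min k (length b)}"] conjI)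
  show "\<tau> ` {..<min k (length b)} \<subseteq> {..<length b}" by (auto simp: in_range)
  show "card (\<tau> ` {..<min k (length b)}) \<le> k"
    using card_image_le[of "{..<min k (length b)}" \<tau>] by simp
  have "sum (decreasing b) {..<k} = sum (decreasing b) {..<min k (length b)}"
    by (rule sum.mono_neutral_right) (auto simp: decreasing_eq)
  also have "\<dots> = (\<Sum>i\<in>\<tau> ` {..<min k (length b)}. b ! i)" by (intro sum_decreasing) auto
  finally show "sum (decreasing b) {..<k} = (\<Sum>i\<in>\<tau> ` {..<min k (length b)}. b ! i)" .
qed

end

section \<open>Sums over residue classes\<close>

definition mod_sum :: "nat \<Rightarrow> nat \<Rightarrow> nat \<Rightarrow> (nat \<Rightarrow> 'a::comm_monoid_add) \<Rightarrow> 'a" where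
  "mod_sum L K j g = (\<Sum>k<K. if k mod L = j then g k else 0)"

text \<open>Splitting off the first index shifts all residues cyclically by one. The operation
  \<open>push\<close> does the same to the queue.\<close>

lemma mod_sum_Suc:
  assumes "j < L"
  shows "mod_sum L (Suc K) j g =
    (if j = 0 then g 0 + mod_sum L K (L - 1) (\<lambda>k. g (Suc k)) else mod_sum L K (j - 1) (\<lambda>k. g (Suc k)))"
proof -
  have "(Suc k mod L = j) = (k mod L = (if j = 0 then L - 1 else j - 1))" for k
    using assms by (auto simp: mod_Suc dest: mod_less_divisor[of L k] split: if_splits)
  then show ?thesis
    using assms unfolding mod_sum_def sum.lessThan_Suc_shift by auto
qed

text \<open>Swapping the sums turns a weighting by aggregated values into a weighting of the
  periodic extension of \<open>h\<close> by the original ones.\<close>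

lemma sum_mod_sum:
  assumes "0 < L"
  shows "(\<Sum>j<L. mod_sum L K j g * h j) = (\<Sum>k<K. g k * h (k mod L) :: real)"
proof -
  have "(\<Sum>j<L. mod_sum L K j g * h j) = (\<Sum>k<K. \<Sum>j<L. (if k mod L = j then g k else 0) * h j)"
    unfolding mod_sum_def sum_distrib_right by (rule sum.swap)
  also have "\<dots> = (\<Sum>k<K. g k * h (k mod L))"
  proof (rule sum.cong[OF refl])
    fix k
    have "(\<Sum>j<L. (if k mod L = j then g k else 0) * h j)
        = (\<Sum>j<L. if k mod L = j then g k * h j else 0)" by (intro sum.cong) auto
    then show "(\<Sum>j<L. (if k mod L = j then g k else 0) * h j) = g k * h (k mod L)"
      using assms by simp
  qed
  finally show ?thesis .
qed

lemma prefix_sum_periodic: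
  fixes y :: "nat \<Rightarrow> real"
  assumes "0 < L"
  shows "(\<Sum>i<k. y (i mod L)) = real (k div L) * sum y {..<L} + sum y {..<k mod L}"
proof (induction k)
  case (Suc k)
  have "sum y {..<L} = sum y {..<k mod L} + y (k mod L)" if "Suc (k mod L) = L"
    using that by (metis sum.lessThan_Suc)
  with Suc show ?case by (auto simp: mod_Suc div_Suc algebra_simps)
qed simp

text \<open>Within a class \<open>k\<close> is determined by \<open>k div L\<close>, which takes
  values up to \<open>K div L\<close>. For \<open>L = 0\<close> the class has at most one element,
  as \<open>k mod 0 = k\<close>.\<close>

lemma card_residue_class: "card {k. k < K \<and> k mod L = j} \<le> Suc (K div L)"
proof (cases "L = 0")
  case True
  then have "{k. k < K \<and> k mod L = j} \<subseteq> {j}" by auto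
  from card_mono[OF _ this] show ?thesis by simp
next
  case False
  have "inj_on (\<lambda>k. k div L) {k. k < K \<and> k mod L = j}"
    by (rule inj_onI) (metis (mono_tags, lifting) div_mult_mod_eq mem_Collect_eq)
  moreover have "(\<lambda>k. k div L) ` {k. k < K \<and> k mod L = j} \<subseteq> {..K div L}"
    by (auto intro: div_le_mono)
  ultimately show ?thesis using card_inj_on_le[of _ _ "{..K div L}"] by fastforce
qed

text \<open>Both averages are rewritten with the same nonincreasing weights \<open>u\<close>, once
  against the sorted values \<open>x\<close> of \<open>f\<close> and once against the periodic
  extension of the sorted values \<open>y\<close> of \<open>a\<close>. Each comparison is then one
  of prefix sums, by \<open>abel_le\<close>.\<close>

lemma owa_round_robin:
  fixes f w :: "real list"
  assumes L: "0 < L" and len: "length w = length f" "length a = L" "length v = L"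
    and f: "\<And>i. i < length f \<Longrightarrow> 0 \<le> f ! i"
    and w: "\<And>i. i < length f \<Longrightarrow> 0 \<le> w ! i"
      "\<And>i j. i \<le> j \<Longrightarrow> j < length f \<Longrightarrow> w ! j \<le> w ! i"
    and a: "\<And>j. j < L \<Longrightarrow> a ! j = mod_sum L (length f) j ((!) f)"
    and v: "\<And>j. j < L \<Longrightarrow> v ! j = mod_sum L (length f) j ((!) w)"
  shows owa_le_round_robin: "owa w f \<le> owa v a"
    and round_robin_le_owa_few: "length f \<le> L \<Longrightarrow> owa v a \<le> owa w f"
    and round_robin_le_owa_many: "L < length f \<Longrightarrow>
      owa v a \<le> 2 * real (Suc (length f div L)) * owa w f"
proof -
  define K where "K = length f"
  \<comment> \<open>Extended by 0, the weights are nonincreasing on all of the natural numbers, as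
    \<open>abel_le\<close> demands.\<close>
  define u where "u i = (if i < K then w ! i else 0)" for i
  have u: "antimono u" "0 \<le> u i" for i using w by (auto simp: u_def K_def antimono_def)
  have f_nonneg: "\<forall>r\<in>set f. 0 \<le> r" using f by (auto simp: in_set_conv_nth)
  have a_nonneg: "\<forall>r\<in>set a. 0 \<le> r"
    using f len by (auto simp: in_set_conv_nth a mod_sum_def intro!: sum_nonneg)
  define x where "x = decreasing f"
  define y where "y = decreasing a"
  note x = antimono_decreasing[OF f_nonneg, folded x_def] decreasing_nonneg[OF f_nonneg, folded x_def]
    owa_eq_decreasing[of _ f, folded x_def K_def] sum_le_decreasing[OF f_nonneg, folded x_def K_def]
    sum_decreasing_attained[OF f_nonneg, folded x_def K_def]
  note y = antimono_decreasing[OF a_nonneg, folded y_def] decreasing_nonneg[OF a_nonneg, folded y_def]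
    owa_eq_decreasing[of _ a, folded y_def, unfolded len(2)]
    sum_le_decreasing[OF a_nonneg, folded y_def, unfolded len(2)]
    sum_decreasing_attained[OF a_nonneg, folded y_def, unfolded len(2)]
  define cls where "cls j = {k. k < K \<and> k mod L = j}" for j
  have a_cls: "a ! j = (\<Sum>k\<in>cls j. f ! k)" if "j < L" for j
  proof -
    have "cls j = {k \<in> {..<K}. k mod L = j}" by (auto simp: cls_def)
    then show ?thesis by (simp only: a[OF that] mod_sum_def K_def sum.inter_filter finite_lessThan)
  qed
  have sum_a: "(\<Sum>j\<in>J. a ! j) = (\<Sum>k\<in>(\<Union>j\<in>J. cls j). f ! k)" if "J \<subseteq> {..<L}" for J
  proof -
    have "finite J" using that by (rule finite_subset) simp
    then have "(\<Sum>k\<in>(\<Union>j\<in>J. cls j). f ! k) = (\<Sum>j\<in>J. \<Sum>k\<in>cls j. f ! k)"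
      by (rule sum.UNION_disjoint) (auto simp: cls_def)
    also have "\<dots> = (\<Sum>j\<in>J. a ! j)" using that by (intro sum.cong refl a_cls[symmetric]) blast
    finally show ?thesis by (rule sym)
  qed
  have owa_w: "owa w f = (\<Sum>i<n. u i * x i)" if "K \<le> n" for n
    unfolding x(3) using that by (intro sum.mono_neutral_cong_left) (auto simp: u_def)
  have owa_v: "owa v a = (\<Sum>i<n. u i * y (i mod L))" if "K \<le> n" for n
  proof -
    have "owa v a = (\<Sum>k<L. mod_sum L K k ((!) w) * y k)" unfolding y(3) K_def using v by simp
    also have "\<dots> = (\<Sum>i<K. w ! i * y (i mod L))" by (rule sum_mod_sum[OF L])
    also have "\<dots> = (\<Sum>i<n. u i * y (i mod L))"
      using that by (intro sum.mono_neutral_cong_left) (auto simp: u_def)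
    finally show ?thesis .
  qed
  \<comment> \<open>The maximizing \<open>S\<close> meets at most \<open>k\<close> classes;
    completing it to the union of these classes only adds nonnegative entries.\<close>
  have lower: "sum x {..<k} \<le> sum y {..<k}" for k
  proof -
    obtain S where S: "S \<subseteq> {..<K}" "card S \<le> k" "sum x {..<k} = (\<Sum>i\<in>S. f ! i)"
      using x(5) by blast
    define J where "J = (\<lambda>i. i mod L) ` S"
    have J: "J \<subseteq> {..<L}" using L by (auto simp: J_def)
    have fin: "finite S" using S(1) finite_subset by blast
    have "(\<Sum>i\<in>S. f ! i) \<le> (\<Sum>k\<in>(\<Union>j\<in>J. cls j). f ! k)"
    proof (rule sum_mono2)
      have "finite J" using fin by (simp add: J_def)
      then show "finite (\<Union>j\<in>J. cls j)" by (auto simp: cls_def)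
      show "S \<subseteq> (\<Union>j\<in>J. cls j)" using S(1) by (auto simp: J_def cls_def)
      show "0 \<le> f ! k" if "k \<in> (\<Union>j\<in>J. cls j) - S" for k
        using that by (intro f) (auto simp: cls_def K_def)
    qed
    also have "\<dots> = (\<Sum>j\<in>J. a ! j)" using sum_a[OF J] by simp
    also have "\<dots> \<le> sum y {..<k}"
      using card_image_le[OF fin, of "\<lambda>i. i mod L"] S(2) by (intro y(4)[OF J]) (simp add: J_def)
    finally show ?thesis using S(3) by simp
  qed
  \<comment> \<open>Any \<open>k\<close> classes contain at most \<open>k * m\<close> entries, and
    \<open>prefix_sum_scale\<close> shortens the prefix from \<open>k * m\<close> to
    \<open>k\<close>. The bound \<open>m\<close> is left open: it is 1 if there are at most
    \<open>L\<close> objectives and \<open>Suc (K div L)\<close> otherwise.\<close>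
  have upper: "sum y {..<k} \<le> real m * sum x {..<k}" if m: "\<And>j. card (cls j) \<le> m" "1 \<le> m" for k m
  proof -
    obtain J where J: "J \<subseteq> {..<L}" "card J \<le> k" "sum y {..<k} = (\<Sum>j\<in>J. a ! j)"
      using y(5) by blast
    have "card (\<Union>j\<in>J. cls j) \<le> (\<Sum>j\<in>J. card (cls j))"
      using finite_subset[OF J(1)] by (intro card_UN_le) auto
    also have "\<dots> \<le> card J * m" using m sum_bounded_above[of J "\<lambda>j. card (cls j)" m] by simp
    also have "\<dots> \<le> k * m" using J by simp
    finally have "(\<Sum>i\<in>(\<Union>j\<in>J. cls j). f ! i) \<le> sum x {..<k * m}"
      by (intro x(4)) (auto simp: cls_def)
    then have "sum y {..<k} \<le> sum x {..<k * m}" using J sum_a by simp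
    moreover have "sum x {..<k * m} \<le> real m * sum x {..<k}"
    \<comment> \<open>The scaled inequality has \<open>k\<close> as a factor on both sides and says
      nothing for \<open>k = 0\<close>, where both prefix sums are empty.\<close>
    proof (cases "k = 0")
      case False
      have "real k * sum x {..<k * m} \<le> real (k * m) * sum x {..<k}"
        using prefix_sum_scale[OF x(1), of k "k * m - k"] m(2) by simp
      then have "real k * sum x {..<k * m} \<le> real k * (real m * sum x {..<k})"
        by (simp add: mult.assoc)
      then show ?thesis using False by (metis mult_le_cancel_left_pos of_nat_0_less_iff gr0I)
    qed simp
    ultimately show ?thesis by simp
  qed
  have "owa w f = (\<Sum>i<K. u i * x i)" by (rule owa_w) simp
  also have "\<dots> \<le> (\<Sum>i<K. u i * y i)" by (rule abel_le[OF u lower])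
  \<comment> \<open>Here \<open>i mod L \<le> i\<close> and \<open>y\<close> is
    nonincreasing.\<close>
  also have "\<dots> \<le> (\<Sum>i<K. u i * y (i mod L))"
    using u(2) y(1) by (intro sum_mono mult_left_mono) (auto simp: antimono_def)
  also have "\<dots> = owa v a" by (rule owa_v[symmetric]) simp
  finally show "owa w f \<le> owa v a" .
  show "owa v a \<le> owa w f" if few: "length f \<le> L"
  proof -
    have "card (cls j) \<le> 1" for j
    proof -
      have "cls j \<subseteq> {j}" using few by (auto simp: cls_def K_def)
      from card_mono[OF _ this] show ?thesis by simp
    qed
    from upper[OF this] have "sum y {..<k} \<le> sum x {..<k}" for k by simp
    then have "(\<Sum>i<K. u i * y i) \<le> (\<Sum>i<K. u i * x i)" by (intro abel_le[OF u])
    also have "(\<Sum>i<K. u i * y i) = (\<Sum>i<K. u i * y (i mod L))"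
      using few by (intro sum.cong) (auto simp: K_def)
    finally show ?thesis using owa_w[of K] owa_v[of K] by simp
  qed
  show "owa v a \<le> 2 * real (Suc (length f div L)) * owa w f" if many: "L < length f"
  proof -
    define m where "m = Suc (K div L)"
    have up: "sum y {..<k} \<le> real m * sum x {..<k}" for k
      using upper[of m] card_residue_class by (simp add: m_def cls_def)
    have mono: "sum x {..<i} \<le> sum x {..<j}" if "i \<le> j" for i j
      using that x(2) by (intro sum_mono2) auto
    have Km: "K \<le> m * L"
    proof -
      have "K = K div L * L + K mod L" by simp
      then show ?thesis using mod_less_divisor[OF L, of K] unfolding m_def mult_Suc by linarith
    qed
    have total: "sum y {..<L} \<le> sum x {..<K}"
    proof -
      obtain J where J: "J \<subseteq> {..<L}" "sum y {..<L} = (\<Sum>j\<in>J. a ! j)" using y(5) by blast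
      have "card (\<Union>j\<in>J. cls j) \<le> card {..<K}" by (intro card_mono) (auto simp: cls_def)
      then show ?thesis unfolding J(2) sum_a[OF J(1)] by (intro x(4)) (auto simp: cls_def)
    qed
    \<comment> \<open>The prefix consists of \<open>k div L\<close> full periods and a remainder;
      each part is at most \<open>m\<close> times the prefix sum of \<open>x\<close>, whence the
      factor 2. For the full periods this combines \<open>L * (k div L) \<le> k\<close>, the bound
      \<open>total\<close> for one period, the comparison of averages over \<open>K\<close> and
      \<open>k\<close> entries, and \<open>K \<le> m * L\<close>.\<close>
    have "(\<Sum>i<k. y (i mod L)) \<le> (\<Sum>i<k. 2 * real m * x i)" if k: "k \<le> K" for k
    proof -
      have "real L * (real (k div L) * sum y {..<L}) = real (L * (k div L)) * sum y {..<L}" by simp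
      also have "\<dots> \<le> real k * sum x {..<K}"
        using total y(2) sum_nonneg[of "{..<L}" y]
        by (intro mult_mono of_nat_mono) auto
      also have "\<dots> \<le> real K * sum x {..<k}" using prefix_sum_scale[OF x(1), of k "K - k"] k by simp
      also have "\<dots> \<le> real (m * L) * sum x {..<k}"
        using Km x(2) by (intro mult_right_mono of_nat_mono sum_nonneg) auto
      also have "\<dots> = real L * (real m * sum x {..<k})" by simp
      finally have "real (k div L) * sum y {..<L} \<le> real m * sum x {..<k}"
        using L by (metis mult_le_cancel_left_pos of_nat_0_less_iff)
      moreover have "sum y {..<k mod L} \<le> real m * sum x {..<k}"
        using up[of "k mod L"] mono[of "k mod L" k]
        by (meson mod_less_eq_dividend mult_left_mono of_nat_0_le_iff order_trans)
      ultimately have "(\<Sum>i<k. y (i mod L)) \<le> 2 * real m * sum x {..<k}"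
        by (simp add: prefix_sum_periodic[OF L])
      then show ?thesis by (simp add: sum_distrib_left)
    qed
    from abel_le[OF u this]
    have "(\<Sum>i<K. u i * y (i mod L)) \<le> 2 * real m * (\<Sum>i<K. u i * x i)"
      by (simp add: sum_distrib_left mult.left_commute mult.assoc)
    then show ?thesis using owa_w[of K] owa_v[of K] unfolding m_def K_def by simp
  qed
qed

section \<open>Cost bounds for programs\<close>

lemma bits_pos: "1 \<le> bits v"
  by (cases v) auto

lemma floorlog_num: "Suc (floorlog 2 (num v)) \<le> bits v"
  by (cases v) (auto simp: floorlog_def)

lemma bits_un: "bits (un f v) \<le> 1 + bits v"
  by (cases v; cases f) (auto simp: floorlog_def)

lemma less_power_floorlog: "x < 2 ^ floorlog 2 x"
  by (rule floorlog_leD) auto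

text \<open>Even a product has at most the sum of the sizes of its factors. Hence the size of any
  fixed expression is linear in the size of the state.\<close>

lemma bits_bin: "bits (bin f u v) \<le> 1 + bits u + bits v"
proof -
  define a b where "a = num u" "b = num v"
  have sz: "Suc (floorlog 2 a) \<le> bits u" "Suc (floorlog 2 b) \<le> bits v"
    using floorlog_num[of u] floorlog_num[of v] by (auto simp: a_b_def)
  have lt: "a < 2 ^ floorlog 2 a" "b < 2 ^ floorlog 2 b" by (rule less_power_floorlog)+
  have "floorlog 2 (a + b) \<le> 1 + floorlog 2 a + floorlog 2 b"
  proof (rule floorlog_leI)
    have "(2::nat) ^ floorlog 2 a \<le> 2 ^ (floorlog 2 a + floorlog 2 b)"
      "(2::nat) ^ floorlog 2 b \<le> 2 ^ (floorlog 2 a + floorlog 2 b)" by (rule power_increasing; simp)+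
    then show "a + b < 2 ^ (1 + floorlog 2 a + floorlog 2 b)"
      using lt unfolding add.assoc power_add[of _ 1] power_one_right by linarith
  qed auto
  moreover have "floorlog 2 (a * b) \<le> floorlog 2 a + floorlog 2 b"
    using lt by (intro floorlog_leI) (auto simp: power_add intro: mult_strict_mono)
  moreover have "floorlog 2 (a - b) \<le> floorlog 2 a" by (rule floorlog_mono) simp
  moreover have "floorlog 2 (a div b) \<le> floorlog 2 a" by (rule floorlog_mono) simp
  moreover have "floorlog 2 (if a < b then 1 else 0) \<le> 1" by (simp add: floorlog_def)
  ultimately show ?thesis using sz by (cases f) (simp_all add: a_b_def[symmetric])
qed

section \<open>Size and cost of expressions, linear in the size of the state\<close>

definition bounded :: "nat \<Rightarrow> state \<Rightarrow> bool" where
  "bounded M s \<longleftrightarrow> (\<forall>x. bits (s x) \<le> M)"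

lemma bounded_pos: "bounded M s \<Longrightarrow> 1 \<le> M"
  unfolding bounded_def using bits_pos order_trans by blast

fun growth :: "expr \<Rightarrow> nat" where
  "growth (Const v) = bits v"
| "growth (Var x) = 1"
| "growth (Op1 f e) = 1 + growth e"
| "growth (Op2 f e e') = 1 + growth e + growth e'"

fun cost_factor :: "expr \<Rightarrow> nat" where
  "cost_factor (Const v) = bits v"
| "cost_factor (Var x) = 1"
| "cost_factor (Op1 f e) = cost_factor e + growth (Op1 f e)"
| "cost_factor (Op2 f e e') = cost_factor e + cost_factor e' + growth (Op2 f e e')"

lemma bits_eval_le:
  assumes "bounded M s"
  shows "bits (eval e s) \<le> growth e * M"
proof (induction e)
  case (Const v)
  then show ?case using bounded_pos[OF assms] by simp
next
  case (Var x)
  then show ?case using assms by (simp add: bounded_def)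
next
  case (Op1 f e)
  then show ?case
    using bits_un[of f "eval e s"] bounded_pos[OF assms] by (simp add: algebra_simps)
next
  case (Op2 f e e')
  then show ?case
    using bits_bin[of f "eval e s" "eval e' s"] bounded_pos[OF assms] by (simp add: algebra_simps)
qed

lemma cost_le:
  assumes "bounded M s"
  shows "cost e s \<le> cost_factor e * M"
proof (induction e)
  case (Const v)
  then show ?case using bounded_pos[OF assms] by simp
next
  case (Var x)
  then show ?case using assms by (simp add: bounded_def)
next
  case (Op1 f e)
  then show ?case using bits_eval_le[OF assms, of "Op1 f e"]
    unfolding cost.simps cost_factor.simps add_mult_distrib by linarith
next
  case (Op2 f e e')
  then show ?case using bits_eval_le[OF assms, of "Op2 f e e'"]
    unfolding cost.simps cost_factor.simps add_mult_distrib by linarith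
qed

section \<open>Running times of straight-line blocks and loops\<close>

definition runs :: "com \<Rightarrow> state \<Rightarrow> nat \<Rightarrow> state \<Rightarrow> bool" where
  "runs c s T s' \<longleftrightarrow> (\<exists>t\<le>T. exec c s t s')"

lemma runs_Assign:
  assumes "bounded M s"
  shows "runs (Assign x e) s (cost_factor e * M) (s(x := eval e s))"
  unfolding runs_def using cost_le[OF assms] exec.Assign by blast

lemma runs_Seq:
  assumes "runs c s T s'" "runs c' s' T' s''"
  shows "runs (Seq c c') s (T + T') s''"
  using assms unfolding runs_def by (meson add_mono exec.Seq)

text \<open>The language has no skip command; the empty block assigns variable 0 to itself.\<close>

fun block :: "(nat \<times> expr) list \<Rightarrow> com" where
  "block [] = Assign 0 (Var 0)"
| "block ((x, e) # as) = Seq (Assign x e) (block as)"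

fun block_state :: "(nat \<times> expr) list \<Rightarrow> state \<Rightarrow> state" where
  "block_state [] s = s"
| "block_state ((x, e) # as) s = block_state as (s(x := eval e s))"

fun block_growth :: "(nat \<times> expr) list \<Rightarrow> nat" where
  "block_growth [] = 1"
| "block_growth ((x, e) # as) = block_growth as * Suc (growth e)"

fun block_cost :: "(nat \<times> expr) list \<Rightarrow> nat" where
  "block_cost [] = 1"
| "block_cost ((x, e) # as) = cost_factor e + block_cost as * Suc (growth e)"

lemma bounded_update:
  assumes "bounded M s"
  shows "bounded (Suc (growth e) * M) (s(x := eval e s))"
  using assms bits_eval_le[OF assms, of e] by (auto simp: bounded_def trans_le_add1 trans_le_add2)

lemma bounded_block: "bounded M s \<Longrightarrow> bounded (block_growth as * M) (block_state as s)"
proof (induction as s arbitrary: M rule: block_state.induct)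
  case (2 x e as s)
  from "2.IH"[OF bounded_update[OF "2.prems"]] show ?case by (simp only: block_state.simps block_growth.simps mult.assoc)
qed simp

lemma runs_block: "bounded M s \<Longrightarrow> runs (block as) s (block_cost as * M) (block_state as s)"
proof (induction as s arbitrary: M rule: block_state.induct)
  case (1 s)
  show ?case using runs_Assign[OF "1.prems", of 0 "Var 0"] by simp
next
  case (2 x e as s)
  from runs_Seq[OF runs_Assign[OF "2.prems"] "2.IH"[OF bounded_update[OF "2.prems"]]]
  show ?case by (simp only: block.simps block_state.simps block_cost.simps mult.assoc add_mult_distrib)
qed

lemma runs_blockI:
  assumes "bounded M s" "block_state as s = s'"
  shows "runs (block as) s (block_cost as * M) s'"
  using runs_block[OF assms(1), of as] unfolding assms(2) .

text \<open>The states \<open>S i\<close> after \<open>i\<close> rounds are given explicitly and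
  share one size bound \<open>M\<close>. Multiplying the factors of \<open>block_growth\<close> over
  the rounds would only give an exponential bound.\<close>

lemma runs_while_list:
  assumes x: "\<And>i. i \<le> length xs \<Longrightarrow> S i x = enc_list f (drop i xs)"
    and bnd: "\<And>i. i \<le> length xs \<Longrightarrow> bounded M (S i)"
    and step: "\<And>i. i < length xs \<Longrightarrow> runs c (S i) T (S (Suc i))"
  shows "runs (While (Op1 IsNode (Var x)) c) (S 0) (length xs * (T + 3 * M) + 3 * M) (S (length xs))"
proof -
  let ?e = "Op1 IsNode (Var x)"
  \<comment> \<open>The 3 is the \<open>cost_factor\<close> of the loop test.\<close>
  have cost: "cost ?e (S i) \<le> 3 * M" if "i \<le> length xs" for i
    using cost_le[OF bnd[OF that], of ?e] by simp
  \<comment> \<open>Induction on the number \<open>k\<close> of remaining rounds, because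
    \<open>exec\<close> unfolds a loop from its first round.\<close>
  have "runs (While ?e c) (S (length xs - k)) (k * (T + 3 * M) + 3 * M) (S (length xs))"
    if "k \<le> length xs" for k
    using that
  proof (induction k)
    case 0
    have "eval ?e (S (length xs)) = Num 0" using x[of "length xs"] by simp
    from exec.WhileFalse[OF this] show ?case
      unfolding runs_def using cost[of "length xs"] by auto
  next
    case (Suc k)
    define i where "i = length xs - Suc k"
    have i: "i < length xs" "Suc i = length xs - k" using Suc.prems by (auto simp: i_def)
    have "S i x = enc_list f (xs ! i # drop (Suc i) xs)"
      using x[of i] i(1) by (simp add: Cons_nth_drop_Suc)
    then have ne: "eval ?e (S i) \<noteq> Num 0" by simp
    obtain t where t: "t \<le> T" "exec c (S i) t (S (Suc i))" using step[OF i(1)] by (auto simp: runs_def)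
    obtain t' where t': "t' \<le> k * (T + 3 * M) + 3 * M" "exec (While ?e c) (S (Suc i)) t' (S (length xs))"
      using Suc i(2) by (auto simp: runs_def)
    have "exec (While ?e c) (S i) (cost ?e (S i) + t + t') (S (length xs))"
      by (rule exec.WhileTrue[OF ne t(2) t'(2)])
    moreover have "cost ?e (S i) + t + t' \<le> Suc k * (T + 3 * M) + 3 * M"
      using cost[of i] i(1) t(1) t'(1) unfolding mult_Suc by linarith
    ultimately show ?case unfolding runs_def i_def by blast
  qed
  from this[of "length xs"] show ?thesis by simp
qed

text \<open>All variables beyond the list hold \<open>Num 0\<close>, as in the initial state of
  \<open>computes\<close>.\<close>

definition st :: "val list \<Rightarrow> state" where
  "st vs x = (if x < length vs then vs ! x else Num 0)"

lemma st_nth [simp]: "x < length vs \<Longrightarrow> st vs x = vs ! x"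
  by (simp add: st_def)

lemma st_update [simp]: "x < length vs \<Longrightarrow> (st vs)(x := v) = st (vs[x := v])"
  by (auto simp: st_def fun_eq_iff)

lemma bounded_st: "bounded M (st vs) \<longleftrightarrow> 1 \<le> M \<and> (\<forall>v\<in>set vs. bits v \<le> M)"
proof
  assume b: "bounded M (st vs)"
  then show "1 \<le> M \<and> (\<forall>v\<in>set vs. bits v \<le> M)"
    using bounded_pos[OF b] unfolding bounded_def by (metis in_set_conv_nth st_nth)
qed (auto simp: bounded_def st_def floorlog_def)

section \<open>Encoded lists: sizes and access\<close>

lemma bits_enc_list: "bits (enc_list f xs) = 1 + (\<Sum>x\<leftarrow>xs. 1 + bits (f x))"
  by (induction xs) (auto simp: floorlog_def)

lemma bits_enc_list_drop: "bits (enc_list f (drop i xs)) \<le> bits (enc_list f xs)"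
proof -
  have "bits (enc_list f (take i xs @ drop i xs)) = bits (enc_list f xs)" by simp
  then show ?thesis unfolding bits_enc_list map_append sum_list_append by linarith
qed

lemma bits_enc_list_rev_take: "bits (enc_list f (rev (take i xs))) \<le> bits (enc_list f xs)"
proof -
  have "bits (enc_list f (take i xs @ drop i xs)) = bits (enc_list f xs)" by simp
  then show ?thesis
    unfolding bits_enc_list map_append sum_list_append rev_map[symmetric] sum_list_rev by linarith
qed

lemma bits_enc_list_le:
  assumes "\<And>x. x \<in> set xs \<Longrightarrow> bits (f x) \<le> B"
  shows "bits (enc_list f xs) \<le> 1 + length xs * (1 + B)"
  unfolding bits_enc_list using assms
proof (induction xs)
  case (Cons x xs)
  then have "(\<Sum>x\<leftarrow>xs. 1 + bits (f x)) \<le> length xs * (1 + B)" "bits (f x) \<le> B" by simp_all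
  then show ?case by simp
qed simp

lemma length_less_bits: "length xs < bits (enc_list f xs)"
  by (induction xs) auto

lemma element_less_bits: "x \<in> set xs \<Longrightarrow> bits (f x) < bits (enc_list f xs)"
  by (induction xs) auto

lemma enc_list_map: "enc_list f (map g xs) = enc_list (\<lambda>x. f (g x)) xs"
  by (induction xs) auto

lemma enc_list_cong: "(\<And>x. x \<in> set xs \<Longrightarrow> f x = g x) \<Longrightarrow> enc_list f xs = enc_list g xs"
  by (induction xs) auto

fun drop_expr :: "nat \<Rightarrow> expr \<Rightarrow> expr" where
  "drop_expr 0 e = e"
| "drop_expr (Suc k) e = Op1 Snd (drop_expr k e)"

text \<open>The index is fixed when the program is written. Since \<open>L\<close> is a constant,
  the queue can be accessed and rebuilt without loops.\<close>

definition nth_expr :: "expr \<Rightarrow> nat \<Rightarrow> expr" where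
  "nth_expr e k = Op1 Fst (drop_expr k e)"

fun list_expr :: "expr list \<Rightarrow> expr" where
  "list_expr [] = Const (Num 0)"
| "list_expr (e # es) = Op2 MkNode e (list_expr es)"

text \<open>No bound on \<open>k\<close> is imposed: \<open>Snd\<close> maps the empty list
  \<open>Num 0\<close> to itself.\<close>

lemma eval_drop_expr:
  assumes "eval e s = enc_list f xs"
  shows "eval (drop_expr k e) s = enc_list f (drop k xs)"
proof (induction k)
  case (Suc k)
  have "drop (Suc k) xs = tl (drop k xs)" by (simp add: drop_Suc tl_drop)
  with Suc show ?case by (cases "drop k xs") simp_all
qed (simp add: assms)

lemma eval_nth_expr:
  assumes "eval e s = enc_list f xs" "k < length xs"
  shows "eval (nth_expr e k) s = f (xs ! k)"
  using eval_drop_expr[OF assms(1), of k] assms(2) by (simp add: nth_expr_def Cons_nth_drop_Suc[symmetric])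

lemma eval_list_expr: "eval (list_expr es) s = enc_list (\<lambda>e. eval e s) es"
  by (induction es) auto

section \<open>The aggregation program\<close>

lemma floorlog_0 [simp]: "floorlog 2 0 = 0"
  by (simp add: floorlog_def)

definition fadd :: "frac \<Rightarrow> frac \<Rightarrow> frac" where
  "fadd r q = (fst r * snd q + fst q * snd r, snd r * snd q)"

text \<open>
  Rows are pushed from the last one to the first, so that in the end entry \<open>j\<close> of the queue is the sum
  of the rows whose index is congruent to \<open>j\<close> modulo \<open>L\<close>.
\<close>

definition push :: "nat \<Rightarrow> frac list \<Rightarrow> frac list list \<Rightarrow> frac list list" where
  "push L r Q = map2 fadd (Q ! (L - 1)) r # take (L - 1) Q"

definition fadd_expr :: "expr \<Rightarrow> expr \<Rightarrow> expr" where
  "fadd_expr e e' = Op2 MkNode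
     (Op2 Plus (Op2 Times (Op1 Fst e) (Op1 Snd e')) (Op2 Times (Op1 Fst e') (Op1 Snd e)))
     (Op2 Times (Op1 Snd e) (Op1 Snd e'))"

lemma eval_fadd_expr:
  "eval e s = enc_frac r \<Longrightarrow> eval e' s = enc_frac q \<Longrightarrow> eval (fadd_expr e e') s = enc_frac (fadd r q)"
  by (simp add: fadd_expr_def enc_frac_def fadd_def)

abbreviation enc_row :: "frac list \<Rightarrow> val" where
  "enc_row \<equiv> enc_list enc_frac"

abbreviation enc_rows :: "frac list list \<Rightarrow> val" where
  "enc_rows \<equiv> enc_list enc_row"

abbreviation for_each :: "nat \<Rightarrow> com \<Rightarrow> com" where
  "for_each x c \<equiv> While (Op1 IsNode (Var x)) c"

abbreviation loop_time :: "nat \<Rightarrow> nat \<Rightarrow> nat \<Rightarrow> nat" where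
  "loop_time M k T \<equiv> k * (T + 3 * M) + 3 * M"

text \<open>
  Variable 0 holds the description \<open>d\<close>, 1 and 2 the cost vectors and weights not yet read, 6 the rows
  (a weight followed by its cost vector) in reverse order, 7 the queue; 3, 4 and 5 are scratch.
\<close>

definition add_body :: "(nat \<times> expr) list" where
  "add_body = [(5, Op2 MkNode (fadd_expr (Op1 Fst (Var 4)) (Op1 Fst (Var 3))) (Var 5)),
     (3, Op1 Snd (Var 3)), (4, Op1 Snd (Var 4))]"

text \<open>Consing onto variable 5 yields the sum in reverse order, which
  \<open>runs_rev_loop\<close> corrects. Partial results are reversed prefixes of the sum, so a size
  bound for the whole sum covers them.\<close>

lemma runs_add_loop:
  assumes len: "length r = length a"
    and bnd: "bounded M (st [d, C, W, enc_row r, enc_row a, enc_row (map2 fadd a r), R, Q])"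
  shows "runs (for_each 3 (block add_body)) (st [d, C, W, enc_row r, enc_row a, Num 0, R, Q])
    (loop_time M (length r) (block_cost add_body * M))
    (st [d, C, W, Num 0, Num 0, enc_row (rev (map2 fadd a r)), R, Q])"
proof -
  define z where "z = map2 fadd a r"
  define S where "S i = st [d, C, W, enc_row (drop i r), enc_row (drop i a),
    enc_row (rev (take i z)), R, Q]" for i
  have b: "bounded M (S i)" for i
    using bnd bits_enc_list_drop[of enc_frac i r] bits_enc_list_drop[of enc_frac i a]
      bits_enc_list_rev_take[of enc_frac i z]
    unfolding S_def bounded_st z_def[symmetric] by simp
  have "runs (for_each 3 (block add_body)) (S 0) (loop_time M (length r) (block_cost add_body * M))
    (S (length r))"
  proof (rule runs_while_list[where f = enc_frac])
    fix i assume i: "i < length r"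
    have "drop i r = r ! i # drop (Suc i) r" "drop i a = a ! i # drop (Suc i) a"
      using i len by (simp_all add: Cons_nth_drop_Suc)
    moreover have "take (Suc i) z = take i z @ [fadd (a ! i) (r ! i)]"
      using i len by (simp add: z_def take_Suc_conv_app_nth)
    ultimately have "block_state add_body (S i) = S (Suc i)"
      by (simp add: S_def add_body_def eval_fadd_expr)
    then show "runs (block add_body) (S i) (block_cost add_body * M) (S (Suc i))"
      by (rule runs_blockI[OF b])
  qed (simp_all add: b, simp add: S_def)
  then show ?thesis using len by (simp add: S_def z_def)
qed

definition rev_body :: "(nat \<times> expr) list" where
  "rev_body = [(4, Op2 MkNode (Op1 Fst (Var 5)) (Var 4)), (5, Op1 Snd (Var 5))]"

lemma runs_rev_loop:
  assumes bnd: "bounded M (st [d, C, W, X, enc_row z, enc_row z, R, Q])"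
  shows "runs (for_each 5 (block rev_body)) (st [d, C, W, X, Num 0, enc_row (rev z), R, Q])
    (loop_time M (length z) (block_cost rev_body * M))
    (st [d, C, W, X, enc_row z, Num 0, R, Q])"
proof -
  define y where "y = rev z"
  define S where "S i = st [d, C, W, X, enc_row (rev (take i y)), enc_row (drop i y), R, Q]" for i
  have "bits (enc_row y) = bits (enc_row z)"
    by (simp add: bits_enc_list y_def rev_map[symmetric])
  then have b: "bounded M (S i)" for i
    using bnd bits_enc_list_drop[of enc_frac i y] bits_enc_list_rev_take[of enc_frac i y]
    unfolding S_def bounded_st by simp
  have "runs (for_each 5 (block rev_body)) (S 0) (loop_time M (length y) (block_cost rev_body * M))
    (S (length y))"
  proof (rule runs_while_list[where f = enc_frac])
    fix i assume i: "i < length y"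
    then have "drop i y = y ! i # drop (Suc i) y" "take (Suc i) y = take i y @ [y ! i]"
      by (simp_all add: Cons_nth_drop_Suc take_Suc_conv_app_nth)
    then have "block_state rev_body (S i) = S (Suc i)" by (simp add: S_def rev_body_def)
    then show "runs (block rev_body) (S i) (block_cost rev_body * M) (S (Suc i))"
      by (rule runs_blockI[OF b])
  qed (simp_all add: b, simp add: S_def)
  then show ?thesis by (simp add: S_def y_def)
qed

definition fetch_body :: "nat \<Rightarrow> (nat \<times> expr) list" where
  "fetch_body L = [(3, Op1 Fst (Var 6)), (4, nth_expr (Var 7) (L - 1))]"

text \<open>The last row of the queue is left out because the new first row has absorbed it.
  Variable 4 is cleared to restore the loop invariant of \<open>runs_push_loop\<close>.\<close>

definition store_body :: "nat \<Rightarrow> (nat \<times> expr) list" where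
  "store_body L = [(7, list_expr (Var 4 # map (nth_expr (Var 7)) [0..<L - 1])),
     (6, Op1 Snd (Var 6)), (4, Const (Num 0))]"

definition push_com :: "nat \<Rightarrow> com" where
  "push_com L = Seq (block (fetch_body L)) (Seq (for_each 3 (block add_body))
     (Seq (for_each 5 (block rev_body)) (block (store_body L))))"

definition push_time :: "nat \<Rightarrow> nat \<Rightarrow> nat \<Rightarrow> nat" where
  "push_time L M k = block_cost (fetch_body L) * M + (loop_time M k (block_cost add_body * M) +
     (loop_time M k (block_cost rev_body * M) + block_cost (store_body L) * M))"

lemma runs_push:
  assumes L: "0 < L" "length Q = L" and len: "length r = length (Q ! (L - 1))"
    and bnd: "bounded M (st [d, C, W, enc_row r, enc_row (Q ! (L - 1)),
      enc_row (map2 fadd (Q ! (L - 1)) r), enc_rows (r # R), enc_rows Q])"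
  shows "runs (push_com L) (st [d, C, W, Num 0, Num 0, Num 0, enc_rows (r # R), enc_rows Q])
    (push_time L M (length r))
    (st [d, C, W, Num 0, Num 0, Num 0, enc_rows R, enc_rows (push L r Q)])"
proof -
  define z where "z = map2 fadd (Q ! (L - 1)) r"
  have lenz: "length z = length r" using len by (simp add: z_def)
  have bits: "1 \<le> M" "bits d \<le> M" "bits C \<le> M" "bits W \<le> M" "bits (enc_row z) \<le> M"
    "bits (enc_rows (r # R)) \<le> M" "bits (enc_rows Q) \<le> M"
    using bnd unfolding bounded_st z_def by simp_all
  have fetch: "runs (block (fetch_body L))
      (st [d, C, W, Num 0, Num 0, Num 0, enc_rows (r # R), enc_rows Q])
      (block_cost (fetch_body L) * M)
      (st [d, C, W, enc_row r, enc_row (Q ! (L - 1)), Num 0, enc_rows (r # R), enc_rows Q])"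
    (is "runs _ ?s _ ?s'")
  proof (rule runs_blockI)
    show "bounded M ?s" using bits unfolding bounded_st by simp
    let ?t = "st [d, C, W, enc_row r, Num 0, Num 0, enc_rows (r # R), enc_rows Q]"
    have "eval (nth_expr (Var 7) (L - 1)) ?t = enc_row (Q ! (L - 1))"
      by (rule eval_nth_expr) (use L in simp_all)
    then show "block_state (fetch_body L) ?s = ?s'" by (simp add: fetch_body_def)
  qed
  have store: "runs (block (store_body L))
      (st [d, C, W, Num 0, enc_row z, Num 0, enc_rows (r # R), enc_rows Q])
      (block_cost (store_body L) * M)
      (st [d, C, W, Num 0, Num 0, Num 0, enc_rows R, enc_rows (push L r Q)])"
    (is "runs _ ?s _ ?s'")
  proof (rule runs_blockI)
    show "bounded M ?s" using bits unfolding bounded_st by simp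
    have "eval (nth_expr (Var 7) k) ?s = enc_row (Q ! k)" if "k < L" for k
      by (rule eval_nth_expr) (use that L in simp_all)
    then have "enc_list (\<lambda>k. eval (nth_expr (Var 7) k) ?s) [0..<L - 1]
      = enc_list (\<lambda>k. enc_row (Q ! k)) [0..<L - 1]" by (intro enc_list_cong) auto
    also have "\<dots> = enc_rows (map ((!) Q) [0..<L - 1])" by (simp only: enc_list_map)
    also have "map ((!) Q) [0..<L - 1] = take (L - 1) Q" using L by (intro nth_equalityI) auto
    finally have "eval (list_expr (Var 4 # map (nth_expr (Var 7)) [0..<L - 1])) ?s
      = enc_rows (push L r Q)"
      by (simp add: eval_list_expr enc_list_map push_def z_def)
    then show "block_state (store_body L) ?s = ?s'"
      by (simp add: store_body_def del: list_expr.simps)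
  qed
  have rev: "runs (for_each 5 (block rev_body))
      (st [d, C, W, Num 0, Num 0, enc_row (rev z), enc_rows (r # R), enc_rows Q])
      (loop_time M (length z) (block_cost rev_body * M))
      (st [d, C, W, Num 0, enc_row z, Num 0, enc_rows (r # R), enc_rows Q])"
    by (rule runs_rev_loop) (use bits in \<open>simp add: bounded_st\<close>)
  show ?thesis
    unfolding push_com_def push_time_def
    by (rule runs_Seq[OF fetch runs_Seq[OF runs_add_loop[OF len bnd]
          runs_Seq[OF rev[unfolded lenz, unfolded z_def] store[unfolded z_def]]]])
qed

section \<open>Initialization, input and output of the aggregation\<close>

abbreviation zero_row :: "nat \<Rightarrow> frac list" where
  "zero_row l \<equiv> replicate l (0, 1)"

definition zero_body :: "(nat \<times> expr) list" where
  "zero_body = [(4, Op2 MkNode (Const (enc_frac (0, 1))) (Var 4)), (3, Op1 Snd (Var 3))]"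

text \<open>The cost vector in variable 3 serves as a unary counter. Starting from a single zero
  provides the additional entry for the weight.\<close>

lemma runs_zero_loop:
  assumes bnd: "bounded M (st [d, C, W, enc_row c, enc_row (zero_row (Suc (length c))), X, R, Q])"
  shows "runs (for_each 3 (block zero_body)) (st [d, C, W, enc_row c, enc_row (zero_row 1), X, R, Q])
    (loop_time M (length c) (block_cost zero_body * M))
    (st [d, C, W, Num 0, enc_row (zero_row (Suc (length c))), X, R, Q])"
proof -
  define S where "S i = st [d, C, W, enc_row (drop i c), enc_row (zero_row (Suc i)), X, R, Q]" for i
  have b: "bounded M (S i)" if "i \<le> length c" for i
  proof -
    \<comment> \<open>The shorter rows are suffixes of the final one and inherit its size
      bound.\<close>
    have "drop (length c - i) (zero_row (Suc (length c))) = zero_row (Suc i)"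
      using that by (simp add: Suc_diff_le del: replicate_Suc)
    then have "bits (enc_row (zero_row (Suc i))) \<le> bits (enc_row (zero_row (Suc (length c))))"
      by (metis bits_enc_list_drop)
    then show ?thesis using bnd bits_enc_list_drop[of enc_frac i c]
      unfolding S_def bounded_st by (simp del: replicate_Suc)
  qed
  have "runs (for_each 3 (block zero_body)) (S 0) (loop_time M (length c) (block_cost zero_body * M))
    (S (length c))"
  proof (rule runs_while_list[where f = enc_frac])
    fix i assume i: "i < length c"
    then have "drop i c = c ! i # drop (Suc i) c" by (simp add: Cons_nth_drop_Suc)
    then have "block_state zero_body (S i) = S (Suc i)" by (simp add: S_def zero_body_def)
    then show "runs (block zero_body) (S i) (block_cost zero_body * M) (S (Suc i))"
      using i by (intro runs_blockI[OF b]) simp_all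
  qed (simp_all add: b, simp add: S_def)
  then show ?thesis by (simp add: S_def)
qed

definition zip_body :: "(nat \<times> expr) list" where
  "zip_body = [(6, Op2 MkNode (Op2 MkNode (Op1 Fst (Var 2)) (Op1 Fst (Var 1))) (Var 6)),
     (1, Op1 Snd (Var 1)), (2, Op1 Snd (Var 2))]"

text \<open>Consing reverses the rows, which is the order in which they have to be pushed.\<close>

lemma runs_zip_loop:
  assumes len: "length w = length C"
    and bnd: "bounded M (st [d, enc_rows C, enc_row w, X, Y, Z, enc_rows (map2 (#) w C), Q])"
  shows "runs (for_each 1 (block zip_body)) (st [d, enc_rows C, enc_row w, X, Y, Z, Num 0, Q])
    (loop_time M (length C) (block_cost zip_body * M))
    (st [d, Num 0, Num 0, X, Y, Z, enc_rows (rev (map2 (#) w C)), Q])"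
proof -
  define rows where "rows = map2 (#) w C"
  define S where "S i = st [d, enc_rows (drop i C), enc_row (drop i w), X, Y, Z,
    enc_rows (rev (take i rows)), Q]" for i
  have b: "bounded M (S i)" for i
    using bnd bits_enc_list_drop[of enc_row i C] bits_enc_list_drop[of enc_frac i w]
      bits_enc_list_rev_take[of enc_row i rows]
    unfolding S_def bounded_st rows_def[symmetric] by simp
  have "runs (for_each 1 (block zip_body)) (S 0) (loop_time M (length C) (block_cost zip_body * M))
    (S (length C))"
  proof (rule runs_while_list[where f = enc_row])
    fix i assume i: "i < length C"
    have "drop i C = C ! i # drop (Suc i) C" "drop i w = w ! i # drop (Suc i) w"
      using i len by (simp_all add: Cons_nth_drop_Suc)
    moreover have "take (Suc i) rows = take i rows @ [w ! i # C ! i]"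
      using i len by (simp add: rows_def take_Suc_conv_app_nth)
    ultimately have "block_state zip_body (S i) = S (Suc i)" by (simp add: S_def zip_body_def)
    then show "runs (block zip_body) (S i) (block_cost zip_body * M) (S (Suc i))"
      by (rule runs_blockI[OF b])
  qed (simp_all add: b, simp add: S_def)
  then show ?thesis using len by (simp add: S_def rows_def)
qed

lemma length_push: "0 < L \<Longrightarrow> length Q = L \<Longrightarrow> length (push L r Q) = L"
  by (simp add: push_def)

lemma length_row_push:
  assumes "0 < L" "length Q = L" "\<forall>q\<in>set Q. length q = l" "length r = l"
  shows "\<forall>q\<in>set (push L r Q). length q = l"
  using assms by (auto simp: push_def dest: in_set_takeD)

lemma fold_push_lengths:
  assumes "0 < L" "length Q = L" "\<forall>q\<in>set Q. length q = l" "\<forall>r\<in>set rs. length r = l"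
  shows "length (fold (push L) rs Q) = L \<and> (\<forall>q\<in>set (fold (push L) rs Q). length q = l)"
  using assms(2-4)
proof (induction rs arbitrary: Q)
  case (Cons r rs)
  have "length (fold (push L) rs (push L r Q)) = L \<and>
    (\<forall>q\<in>set (fold (push L) rs (push L r Q)). length q = l)"
    using Cons.prems assms(1) by (intro Cons.IH length_push length_row_push) auto
  then show ?case by simp
qed simp

text \<open>The size bound for the intermediate queues is a hypothesis here;
  \<open>runs_aggregate_poly\<close> supplies it from \<open>small_fold_push\<close>.\<close>

lemma runs_push_loop:
  assumes L: "0 < L" "length Q = L" and len: "\<forall>q\<in>set Q. length q = l" "\<forall>r\<in>set rs. length r = l"
    and bits: "bits d \<le> M" "bits (enc_rows rs) \<le> M"
      "\<And>i. i \<le> length rs \<Longrightarrow> bits (enc_rows (fold (push L) (take i rs) Q)) \<le> M"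
  shows "runs (for_each 6 (push_com L)) (st [d, Num 0, Num 0, Num 0, Num 0, Num 0, enc_rows rs, enc_rows Q])
    (loop_time M (length rs) (push_time L M l))
    (st [d, Num 0, Num 0, Num 0, Num 0, Num 0, Num 0, enc_rows (fold (push L) rs Q)])"
proof -
  define F where "F i = fold (push L) (take i rs) Q" for i
  define S where "S i = st [d, Num 0, Num 0, Num 0, Num 0, Num 0, enc_rows (drop i rs), enc_rows (F i)]" for i
  have M: "1 \<le> M" using bits(1) bits_pos order_trans by blast
  have F: "length (F i) = L" "\<forall>q\<in>set (F i). length q = l" for i
    using fold_push_lengths[OF L len(1), of "take i rs"] len(2) by (auto simp: F_def dest: in_set_takeD)
  have b: "bounded M (S i)" if "i \<le> length rs" for i
    using M bits(1,2) bits(3)[OF that] bits_enc_list_drop[of enc_row i rs]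
    unfolding S_def bounded_st F_def by simp
  have "runs (for_each 6 (push_com L)) (S 0) (loop_time M (length rs) (push_time L M l)) (S (length rs))"
  proof (rule runs_while_list[where f = enc_row])
    fix i assume i: "i < length rs"
    define r where "r = rs ! i"
    define q where "q = F i ! (L - 1)"
    have drop: "drop i rs = r # drop (Suc i) rs" using i by (simp add: r_def Cons_nth_drop_Suc)
    have step: "F (Suc i) = push L r (F i)"
      using i by (simp add: F_def r_def take_Suc_conv_app_nth)
    have r: "r \<in> set rs" "length r = l" using i len(2) by (simp_all add: r_def)
    have q: "q \<in> set (F i)" "length q = l" using F[of i] L(1) by (simp_all add: q_def)
    have "bits (enc_row r) \<le> M" using element_less_bits[OF r(1), of enc_row] bits(2) by simp
    moreover have "bits (enc_row q) \<le> M"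
      using element_less_bits[OF q(1), of enc_row] bits(3)[of i] i by (simp add: F_def)
    \<comment> \<open>The sum is the first row of the next queue, whose size is bounded by
      hypothesis.\<close>
    moreover have "bits (enc_row (map2 fadd q r)) \<le> M"
    proof -
      have "map2 fadd q r \<in> set (F (Suc i))" by (simp add: step push_def q_def)
      from element_less_bits[OF this, of enc_row] show ?thesis
        using bits(3)[of "Suc i"] i by (simp add: F_def)
    qed
    moreover have "bits (enc_rows (r # drop (Suc i) rs)) \<le> M"
      using bits(2) bits_enc_list_drop[of enc_row i rs] by (simp only: drop)
    moreover have "bits (enc_rows (F i)) \<le> M" using bits(3)[of i] i by (simp add: F_def)
    ultimately have "bounded M (st [d, Num 0, Num 0, enc_row r, enc_row q, enc_row (map2 fadd q r),
        enc_rows (r # drop (Suc i) rs), enc_rows (F i)])"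
      using M bits(1) unfolding bounded_st by simp
    from runs_push[OF L(1) F(1) _ this[unfolded q_def]]
    show "runs (push_com L) (S i) (push_time L M l) (S (Suc i))"
      using r(2) q(2) by (simp only: S_def drop step q_def)
  qed (simp_all add: b, simp add: S_def)
  then show ?thesis by (simp add: S_def F_def)
qed

text \<open>Variable 0 is overwritten by the description only after the other parts of the input
  have been read. The first cost vector goes to variable 3 as the counter for the zero row.\<close>

definition init_body :: "(nat \<times> expr) list" where
  "init_body = [(3, Op1 Fst (Op1 Fst (Op1 Snd (Var 0)))), (1, Op1 Fst (Op1 Snd (Var 0))),
     (2, Op1 Snd (Op1 Snd (Var 0))), (0, Op1 Fst (Var 0)), (4, Const (enc_row (zero_row 1)))]"

definition queue_body :: "nat \<Rightarrow> (nat \<times> expr) list" where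
  "queue_body L = [(7, list_expr (replicate L (Var 4))), (4, Const (Num 0))]"

text \<open>Clearing variable 7 leaves a state in which only variable 0 may be nonzero, so another
  program can be started on the output directly.\<close>

definition out_body :: "nat \<Rightarrow> (nat \<times> expr) list" where
  "out_body L = [(0, Op2 MkNode (Var 0)
     (Op2 MkNode (list_expr (map (\<lambda>k. Op1 Snd (nth_expr (Var 7) k)) [0..<L]))
       (list_expr (map (\<lambda>k. Op1 Fst (nth_expr (Var 7) k)) [0..<L])))), (7, Const (Num 0))]"

definition aggregate :: "nat \<Rightarrow> nat \<Rightarrow> frac list list \<Rightarrow> frac list list" where
  "aggregate L l rows = foldr (push L) rows (replicate L (zero_row l))"

definition aggregate_com :: "nat \<Rightarrow> com" where
  "aggregate_com L = Seq (block init_body) (Seq (for_each 3 (block zero_body))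
     (Seq (block (queue_body L)) (Seq (for_each 1 (block zip_body))
     (Seq (for_each 6 (push_com L)) (block (out_body L))))))"

definition aggregate_time :: "nat \<Rightarrow> nat \<Rightarrow> nat \<Rightarrow> nat \<Rightarrow> nat" where
  "aggregate_time L M n K = block_cost init_body * M + (loop_time M n (block_cost zero_body * M) +
     (block_cost (queue_body L) * M + (loop_time M K (block_cost zip_body * M) +
     (loop_time M K (push_time L M (Suc n)) + block_cost (out_body L) * M))))"

lemma eval_unzip:
  assumes Q: "s 7 = enc_rows Q" "length Q = L" "\<forall>q\<in>set Q. q \<noteq> []"
  shows "eval (list_expr (map (\<lambda>k. Op1 Snd (nth_expr (Var 7) k)) [0..<L])) s = enc_rows (map tl Q)"
    and "eval (list_expr (map (\<lambda>k. Op1 Fst (nth_expr (Var 7) k)) [0..<L])) s = enc_row (map hd Q)"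
proof -
  have Q_map: "Q = map ((!) Q) [0..<L]" using Q(2) by (simp add: map_nth flip: Q(2))
  have row: "eval (nth_expr (Var 7) k) s = Node (enc_frac (hd (Q ! k))) (enc_row (tl (Q ! k)))"
    if "k < L" for k
  proof -
    have "eval (nth_expr (Var 7) k) s = enc_row (Q ! k)"
      by (rule eval_nth_expr) (use Q that in simp_all)
    moreover have "Q ! k \<noteq> []" using Q that by simp
    ultimately show ?thesis by (cases "Q ! k") simp_all
  qed
  have "eval (list_expr (map (\<lambda>k. Op1 Snd (nth_expr (Var 7) k)) [0..<L])) s
      = enc_list (\<lambda>k. enc_row (tl (Q ! k))) [0..<L]"
    unfolding eval_list_expr enc_list_map by (rule enc_list_cong) (simp add: row)
  also have "\<dots> = enc_rows (map tl (map ((!) Q) [0..<L]))" unfolding enc_list_map ..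
  finally show "eval (list_expr (map (\<lambda>k. Op1 Snd (nth_expr (Var 7) k)) [0..<L])) s
      = enc_rows (map tl Q)" unfolding Q_map[symmetric] .
  have "eval (list_expr (map (\<lambda>k. Op1 Fst (nth_expr (Var 7) k)) [0..<L])) s
      = enc_list (\<lambda>k. enc_frac (hd (Q ! k))) [0..<L]"
    unfolding eval_list_expr enc_list_map by (rule enc_list_cong) (simp add: row)
  also have "\<dots> = enc_row (map hd (map ((!) Q) [0..<L]))" unfolding enc_list_map ..
  finally show "eval (list_expr (map (\<lambda>k. Op1 Fst (nth_expr (Var 7) k)) [0..<L])) s
      = enc_row (map hd Q)" unfolding Q_map[symmetric] .
qed

text \<open>\<open>C\<close> has to be nonempty because the program reads the dimension off the
  first cost vector.\<close>

lemma runs_aggregate: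
  assumes L: "0 < L" and len: "C \<noteq> []" "length w = length C" "\<forall>c\<in>set C. length c = n"
    and bits: "bits (enc_instance d C w) \<le> M" "bits (enc_rows (map2 (#) w C)) \<le> M"
      "bits (enc_row (zero_row (Suc n))) \<le> M"
      "\<And>i. i \<le> length C \<Longrightarrow> bits (enc_rows (fold (push L) (take i (rev (map2 (#) w C)))
        (replicate L (zero_row (Suc n))))) \<le> M"
  defines "Q \<equiv> aggregate L (Suc n) (map2 (#) w C)"
  defines "out \<equiv> enc_instance d (map tl Q) (map hd Q)"
  shows "runs (aggregate_com L) ((\<lambda>_. Num 0)(0 := enc_instance d C w))
      (aggregate_time L M n (length C)) ((\<lambda>_. Num 0)(0 := out))"
    and "bits out \<le> block_growth (out_body L) * M"
proof -
  define rows where "rows = map2 (#) w C"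
  define Q0 where "Q0 = replicate L (zero_row (Suc n))"
  obtain c C' where C: "C = c # C'" using len(1) by (cases C) auto
  have c: "length c = n" using len(3) C by simp
  have M: "1 \<le> M" using bits(1) bits_pos order_trans by blast
  have sz: "bits d \<le> M" "bits (enc_rows C) \<le> M" "bits (enc_row w) \<le> M" "bits (enc_row c) \<le> M"
    using bits(1) by (simp_all add: enc_instance_def C)
  have sz_rows: "bits (enc_rows rows) \<le> M" "bits (enc_rows (rev rows)) \<le> M"
    using bits(2) by (simp_all add: rows_def bits_enc_list rev_map[symmetric])
  have start: "(\<lambda>_. Num 0)(0 := v) = st [v, Num 0, Num 0, Num 0, Num 0, Num 0, Num 0, Num 0]" for v
    by (auto simp: st_def fun_eq_iff less_Suc_eq nth_Cons split: nat.splits)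
  have len_rows: "\<forall>r\<in>set rows. length r = Suc n"
    using len(3) by (auto simp: rows_def dest!: set_zip_rightD)
  have len_Q0: "length Q0 = L" "\<forall>q\<in>set Q0. length q = Suc n" by (simp_all add: Q0_def)
  have Q: "Q = fold (push L) (rev rows) Q0"
    by (simp add: Q_def aggregate_def foldr_conv_fold rows_def Q0_def)
  have Q_len: "length Q = L" "\<forall>q\<in>set Q. length q = Suc n"
    using fold_push_lengths[OF L len_Q0, of "rev rows"] len_rows by (simp_all add: Q)
  have sz_Q: "bits (enc_rows (fold (push L) (take i (rev rows)) Q0)) \<le> M" if "i \<le> length (rev rows)" for i
    using that bits(4)[of i] len(2) by (simp add: rows_def Q0_def)
  have init: "runs (block init_body) ((\<lambda>_. Num 0)(0 := enc_instance d C w)) (block_cost init_body * M)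
      (st [d, enc_rows C, enc_row w, enc_row c, enc_row (zero_row 1), Num 0, Num 0, Num 0])"
  proof (rule runs_blockI)
    show "bounded M ((\<lambda>_. Num 0)(0 := enc_instance d C w))"
      using bits(1) M by (simp add: bounded_def)
    show "block_state init_body ((\<lambda>_. Num 0)(0 := enc_instance d C w)) =
      st [d, enc_rows C, enc_row w, enc_row c, enc_row (zero_row 1), Num 0, Num 0, Num 0]"
      unfolding start by (simp add: init_body_def enc_instance_def C)
  qed
  have zero: "runs (for_each 3 (block zero_body))
      (st [d, enc_rows C, enc_row w, enc_row c, enc_row (zero_row 1), Num 0, Num 0, Num 0])
      (loop_time M n (block_cost zero_body * M))
      (st [d, enc_rows C, enc_row w, Num 0, enc_row (zero_row (Suc n)), Num 0, Num 0, Num 0])"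
    by (rule runs_zero_loop[of M d _ _ c, unfolded c])
      (use M sz bits(3) in \<open>simp add: bounded_st del: replicate_Suc\<close>)
  have queue: "runs (block (queue_body L))
      (st [d, enc_rows C, enc_row w, Num 0, enc_row (zero_row (Suc n)), Num 0, Num 0, Num 0])
      (block_cost (queue_body L) * M)
      (st [d, enc_rows C, enc_row w, Num 0, Num 0, Num 0, Num 0, enc_rows Q0])"
    (is "runs _ ?s _ ?s'")
  proof (rule runs_blockI)
    show "bounded M ?s" using M sz bits(3) by (simp add: bounded_st del: replicate_Suc)
    have "enc_list (\<lambda>e. eval e ?s) (replicate L (Var 4)) = enc_rows Q0"
      unfolding Q0_def by (induction L) simp_all
    then show "block_state (queue_body L) ?s = ?s'"
      by (simp add: queue_body_def eval_list_expr del: replicate_Suc)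
  qed
  have zip: "runs (for_each 1 (block zip_body))
      (st [d, enc_rows C, enc_row w, Num 0, Num 0, Num 0, Num 0, enc_rows Q0])
      (loop_time M (length C) (block_cost zip_body * M))
      (st [d, Num 0, Num 0, Num 0, Num 0, Num 0, enc_rows (rev rows), enc_rows Q0])"
    unfolding rows_def
    by (rule runs_zip_loop[OF len(2)])
      (use M sz sz_rows sz_Q[of 0] in \<open>simp add: bounded_st rows_def\<close>)
  have push: "runs (for_each 6 (push_com L))
      (st [d, Num 0, Num 0, Num 0, Num 0, Num 0, enc_rows (rev rows), enc_rows Q0])
      (loop_time M (length (rev rows)) (push_time L M (Suc n)))
      (st [d, Num 0, Num 0, Num 0, Num 0, Num 0, Num 0, enc_rows Q])"
    unfolding Q by (rule runs_push_loop[OF L len_Q0 _ sz(1) sz_rows(2) sz_Q]) (use len_rows in simp_all)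
  have lenr: "length (rev rows) = length C" using len(2) by (simp add: rows_def)
  let ?s = "st [d, Num 0, Num 0, Num 0, Num 0, Num 0, Num 0, enc_rows Q]"
  have bs: "bounded M ?s" using M sz(1) sz_Q[of "length (rev rows)"] by (simp add: bounded_st Q)
  have "\<forall>q\<in>set Q. q \<noteq> []" using Q_len(2) by auto
  note unzip = eval_unzip[of ?s, OF _ Q_len(1) this, simplified]
  have out_state: "block_state (out_body L) ?s = (\<lambda>_. Num 0)(0 := out)"
    unfolding start by (simp add: out_body_def unzip out_def enc_instance_def)
  have out: "runs (block (out_body L)) ?s (block_cost (out_body L) * M) ((\<lambda>_. Num 0)(0 := out))"
    by (rule runs_blockI[OF bs out_state])
  show "runs (aggregate_com L) ((\<lambda>_. Num 0)(0 := enc_instance d C w))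
      (aggregate_time L M n (length C)) ((\<lambda>_. Num 0)(0 := out))"
    unfolding aggregate_com_def aggregate_time_def
    by (rule runs_Seq[OF init runs_Seq[OF zero runs_Seq[OF queue runs_Seq[OF zip
          runs_Seq[OF push[unfolded lenr] out]]]]])
  have "bounded (block_growth (out_body L) * M) ((\<lambda>_. Num 0)(0 := out))"
    using bounded_block[OF bs, of "out_body L"] unfolding out_state .
  then show "bits out \<le> block_growth (out_body L) * M"
    unfolding bounded_def by (metis fun_upd_same)
qed

section \<open>Polynomial size of the aggregated fractions\<close>

definition small :: "nat \<Rightarrow> frac list \<Rightarrow> bool" where
  "small e r \<longleftrightarrow> (\<forall>q\<in>set r. fst q < 2 ^ e \<and> snd q < 2 ^ e)"

lemma small_mono: "small e r \<Longrightarrow> e \<le> e' \<Longrightarrow> small e' r"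
  unfolding small_def by (meson less_le_trans one_le_numeral power_increasing)

lemma bits_enc_frac_le:
  assumes "fst q < 2 ^ e" "snd q < 2 ^ e"
  shows "bits (enc_frac q) \<le> 3 + 2 * e"
  using floorlog_leI[OF assms(1)] floorlog_leI[OF assms(2)] by (simp add: enc_frac_def)

lemma less_power_bits:
  assumes "bits (enc_frac q) \<le> e"
  shows "fst q < 2 ^ e" "snd q < 2 ^ e"
  using assms by (auto simp: enc_frac_def intro!: floorlog_leD)

lemma bits_enc_row_le: "small e r \<Longrightarrow> bits (enc_row r) \<le> 1 + length r * (4 + 2 * e)"
  using bits_enc_list_le[of r enc_frac "3 + 2 * e"] bits_enc_frac_le by (simp add: small_def)

text \<open>Products of entries stay below \<open>2 ^ (e + e')\<close>; the additional 1 is for the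
  sum of two products in the numerator.\<close>

lemma small_fadd:
  assumes "small e a" "small e' r"
  shows "small (e + e' + 1) (map2 fadd a r)"
  unfolding small_def
proof
  fix z assume "z \<in> set (map2 fadd a r)"
  then obtain p q where z: "z = fadd p q" and "(p, q) \<in> set (zip a r)" by auto
  then have "p \<in> set a" "q \<in> set r" by (auto dest: set_zip_leftD set_zip_rightD)
  then have lt: "fst p < 2 ^ e" "snd p < 2 ^ e" "fst q < 2 ^ e'" "snd q < 2 ^ e'"
    using assms by (auto simp: small_def)
  have "fst p * snd q < 2 ^ e * 2 ^ e'" "fst q * snd p < 2 ^ e' * 2 ^ e" "snd p * snd q < 2 ^ e * 2 ^ e'"
    using lt by (auto intro!: mult_strict_mono)
  then show "fst z < 2 ^ (e + e' + 1) \<and> snd z < 2 ^ (e + e' + 1)"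
    by (simp add: z fadd_def power_add mult.commute)
qed

lemma small_push:
  assumes "0 < L" "length Q = L" "\<forall>q\<in>set Q. small e q" "small e' r"
  shows "\<forall>q\<in>set (push L r Q). small (e + e' + 1) q"
proof -
  have "small e (Q ! (L - 1))" using assms by simp
  then show ?thesis
    using assms small_fadd small_mono[of e _ "e + e' + 1"]
    by (auto simp: push_def simp del: One_nat_def dest: in_set_takeD)
qed

text \<open>One summand in each addition is an input row, so a push raises the exponent by the
  constant \<open>e' + 1\<close> instead of doubling it.\<close>

lemma small_fold_push:
  assumes "0 < L" "length Q = L" "\<forall>q\<in>set Q. small e q" "\<forall>r\<in>set rs. small e' r"
  shows "\<forall>q\<in>set (fold (push L) rs Q). small (e + length rs * (e' + 1)) q"
  using assms(2-4)
proof (induction rs arbitrary: Q e)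
  case (Cons r rs)
  have "\<forall>q\<in>set (fold (push L) rs (push L r Q)). small (e + e' + 1 + length rs * (e' + 1)) q"
    using Cons.prems assms(1) by (intro Cons.IH length_push small_push) auto
  then show ?case by (simp add: algebra_simps)
qed simp

text \<open>A row has at most \<open>N + 1\<close> entries, weight included. The exponent
  \<open>1 + N * (N + 1)\<close> is what \<open>small_fold_push\<close> gives for at most
  \<open>N\<close> rows with entries below \<open>2 ^ N\<close>, pushed onto rows of zeros, which
  are \<open>small 1\<close> because of the denominator 1.\<close>

definition row_bound :: "nat \<Rightarrow> nat" where
  "row_bound N = 1 + (N + 1) * (4 + 2 * (1 + N * (N + 1)))"

text \<open>The length \<open>N + L\<close> covers both the at most \<open>N\<close> input rows and
  the \<open>L\<close> rows of the queue.\<close>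

definition size_bound :: "nat \<Rightarrow> nat \<Rightarrow> nat" where
  "size_bound L N = 1 + (N + L) * (1 + row_bound N)"

lemma bits_small_row:
  assumes "small (1 + N * (N + 1)) r" "length r \<le> N + 1"
  shows "bits (enc_row r) \<le> row_bound N"
proof -
  have "length r * (4 + 2 * (1 + N * (N + 1))) \<le> (N + 1) * (4 + 2 * (1 + N * (N + 1)))"
    using assms(2) by (rule mult_right_mono) simp
  then show ?thesis using bits_enc_row_le[OF assms(1)] unfolding row_bound_def by linarith
qed

lemma bits_small_rows:
  assumes "\<forall>r\<in>set R. small (1 + N * (N + 1)) r \<and> length r \<le> N + 1" "length R \<le> N + L"
  shows "bits (enc_rows R) \<le> size_bound L N"
proof -
  have "bits (enc_rows R) \<le> 1 + length R * (1 + row_bound N)"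
    using assms(1) by (intro bits_enc_list_le bits_small_row) auto
  also have "\<dots> \<le> size_bound L N"
    unfolding size_bound_def using assms(2) by (intro add_left_mono mult_right_mono) simp_all
  finally show ?thesis .
qed

lemma runs_aggregate_poly:
  fixes d :: val
  assumes L: "0 < L" and len: "C \<noteq> []" "length w = length C" "\<forall>c\<in>set C. length c = n"
  defines "N \<equiv> bits (enc_instance d C w)"
  defines "Q \<equiv> aggregate L (Suc n) (map2 (#) w C)"
  defines "out \<equiv> enc_instance d (map tl Q) (map hd Q)"
  shows "runs (aggregate_com L) ((\<lambda>_. Num 0)(0 := enc_instance d C w))
      (aggregate_time L (size_bound L N) N N) ((\<lambda>_. Num 0)(0 := out))"
    and "bits out \<le> block_growth (out_body L) * size_bound L N"
proof -
  define rows where "rows = map2 (#) w C"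
  define E where "E = 1 + N * (N + 1)"
  have NE: "N \<le> E" by (simp add: E_def)
  have Nw: "bits (enc_row w) \<le> N" and NC: "bits (enc_rows C) \<le> N"
    by (simp_all add: N_def enc_instance_def)
  have K: "length C \<le> N" using length_less_bits[of C enc_row] NC by simp
  have small_C: "small N c" if "c \<in> set C" for c
    unfolding small_def
  proof
    fix q assume "q \<in> set c"
    then have "bits (enc_frac q) \<le> N"
      using element_less_bits[of q c enc_frac] element_less_bits[OF that, of enc_row] NC by simp
    then show "fst q < 2 ^ N \<and> snd q < 2 ^ N" using less_power_bits by blast
  qed
  have small_w: "fst q < 2 ^ N \<and> snd q < 2 ^ N" if "q \<in> set w" for q
  proof -
    have "bits (enc_frac q) \<le> N" using element_less_bits[OF that, of enc_frac] Nw by simp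
    then show ?thesis using less_power_bits by blast
  qed
  have n: "n \<le> N"
  proof -
    obtain c where c: "c \<in> set C" using len(1) by (cases C) auto
    then show ?thesis
      using len(3) length_less_bits[of c enc_frac] element_less_bits[OF c, of enc_row] NC by simp
  qed
  have rows: "small N r \<and> length r = Suc n" if r: "r \<in> set rows" for r
  proof -
    obtain q c where "r = q # c" "q \<in> set w" "c \<in> set C"
      using r unfolding rows_def by (auto dest: set_zip_leftD set_zip_rightD)
    then show ?thesis using small_w[of q] small_C[of c] len(3) by (simp add: small_def)
  qed
  have rows_E: "small E r \<and> length r \<le> N + 1" if "r \<in> set rows" for r
    using rows[OF that] n NE small_mono by auto
  define Q0 where "Q0 = replicate L (zero_row (Suc n))"
  have Q0: "length Q0 = L" "\<forall>q\<in>set Q0. small 1 q" "\<forall>q\<in>set Q0. length q = Suc n"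
    by (auto simp: Q0_def small_def)
  have M: "row_bound N \<le> size_bound L N" "N \<le> size_bound L N"
  proof -
    have le: "1 * (1 + row_bound N) \<le> (N + L) * (1 + row_bound N)" "(N + L) * 1 \<le> (N + L) * (1 + row_bound N)"
      using L by (intro mult_right_mono mult_left_mono; simp)+
    have "row_bound N \<le> 1 * (1 + row_bound N)" "N \<le> (N + L) * 1" by simp_all
    moreover have "(N + L) * (1 + row_bound N) \<le> size_bound L N"
      unfolding size_bound_def by (rule le_add2)
    ultimately show "row_bound N \<le> size_bound L N" "N \<le> size_bound L N"
      using le order_trans by blast+
  qed
  have sz_rows: "bits (enc_rows rows) \<le> size_bound L N"
    using rows_E K len(2) by (intro bits_small_rows) (auto simp: E_def rows_def)
  have "small E (zero_row (Suc n))" by (rule small_mono[of 1]) (auto simp: small_def E_def)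
  then have sz_zero: "bits (enc_row (zero_row (Suc n))) \<le> size_bound L N"
    using bits_small_row[of N "zero_row (Suc n)"] n M(1) by (simp add: E_def del: replicate_Suc)
  have sz_Q: "bits (enc_rows (fold (push L) (take i (rev rows)) Q0)) \<le> size_bound L N"
    if i: "i \<le> length C" for i
  proof (rule bits_small_rows)
    have sub: "\<forall>r\<in>set (take i (rev rows)). small N r \<and> length r = Suc n"
      using rows by (auto dest: in_set_takeD)
    have l: "length (fold (push L) (take i (rev rows)) Q0) = L \<and>
      (\<forall>q\<in>set (fold (push L) (take i (rev rows)) Q0). length q = Suc n)"
      using fold_push_lengths[OF L Q0(1,3)] sub by blast
    then show "length (fold (push L) (take i (rev rows)) Q0) \<le> N + L" by simp
    have s: "\<forall>q\<in>set (fold (push L) (take i (rev rows)) Q0).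
        small (1 + length (take i (rev rows)) * (N + 1)) q"
      using sub by (intro small_fold_push[OF L Q0(1,2)]) blast
    have "length (take i (rev rows)) \<le> N" using i K by simp
    then have "1 + length (take i (rev rows)) * (N + 1) \<le> 1 + N * (N + 1)"
      by (intro add_left_mono mult_right_mono) simp_all
    then show "\<forall>r\<in>set (fold (push L) (take i (rev rows)) Q0).
        small (1 + N * (N + 1)) r \<and> length r \<le> N + 1"
      using s l n small_mono by auto
  qed
  have run: "runs (aggregate_com L) ((\<lambda>_. Num 0)(0 := enc_instance d C w))
      (aggregate_time L (size_bound L N) n (length C)) ((\<lambda>_. Num 0)(0 := out))"
    unfolding out_def Q_def
    by (rule runs_aggregate(1)[OF L len])
      (use M(2) sz_rows sz_zero sz_Q in \<open>simp_all add: N_def rows_def Q0_def del: replicate_Suc\<close>)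
  show "bits out \<le> block_growth (out_body L) * size_bound L N"
    unfolding out_def Q_def
    by (rule runs_aggregate(2)[OF L len])
      (use M(2) sz_rows sz_zero sz_Q in \<open>simp_all add: N_def rows_def Q0_def del: replicate_Suc\<close>)
  have "aggregate_time L (size_bound L N) n (length C) \<le> aggregate_time L (size_bound L N) N N"
    unfolding aggregate_time_def push_time_def
    using n K by (intro add_mono mult_mono order_refl) simp_all
  with run show "runs (aggregate_com L) ((\<lambda>_. Num 0)(0 := enc_instance d C w))
      (aggregate_time L (size_bound L N) N N) ((\<lambda>_. Num 0)(0 := out))"
    unfolding runs_def using order_trans by blast
qed

section \<open>Values of the aggregated fractions\<close>

lemma frac_val_fadd:
  assumes "is_frac p" "is_frac q"
  shows "is_frac (fadd p q)" "frac_val (fadd p q) = frac_val p + frac_val q"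
  using assms by (simp_all add: is_frac_def frac_val_def fadd_def field_simps)

text \<open>Induction on the rows: pushing a row moves entry \<open>j - 1\<close> of the queue to
  \<open>j\<close> and adds the row to what was entry \<open>L - 1\<close>, in agreement with
  \<open>mod_sum_Suc\<close>.\<close>

lemma aggregate_values:
  assumes L: "0 < L" and rows: "\<forall>r\<in>set rows. length r = l \<and> (\<forall>q\<in>set r. is_frac q)"
  shows "length (aggregate L l rows) = L"
    and "j < L \<Longrightarrow> length (aggregate L l rows ! j) = l"
    and "j < L \<Longrightarrow> i < l \<Longrightarrow> is_frac (aggregate L l rows ! j ! i) \<and>
      frac_val (aggregate L l rows ! j ! i) = mod_sum L (length rows) j (\<lambda>k. frac_val (rows ! k ! i))"
proof -
  have *: "length (aggregate L l rows) = L \<and> (\<forall>j<L. length (aggregate L l rows ! j) = l \<and>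
    (\<forall>i<l. is_frac (aggregate L l rows ! j ! i) \<and>
      frac_val (aggregate L l rows ! j ! i) = mod_sum L (length rows) j (\<lambda>k. frac_val (rows ! k ! i))))"
    using rows
  proof (induction rows)
    case Nil
    show ?case by (simp add: aggregate_def is_frac_def frac_val_def mod_sum_def)
  next
    case (Cons r rows)
    define Q where "Q = aggregate L l rows"
    have IH: "length Q = L" "\<And>j. j < L \<Longrightarrow> length (Q ! j) = l"
      "\<And>j i. j < L \<Longrightarrow> i < l \<Longrightarrow> is_frac (Q ! j ! i)"
      "\<And>j i. j < L \<Longrightarrow> i < l \<Longrightarrow>
        frac_val (Q ! j ! i) = mod_sum L (length rows) j (\<lambda>k. frac_val (rows ! k ! i))"
      using Cons unfolding Q_def by simp_all
    have r: "length r = l" "\<And>i. i < l \<Longrightarrow> is_frac (r ! i)" using Cons.prems by auto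
    have agg: "aggregate L l (r # rows) = map2 fadd (Q ! (L - 1)) r # take (L - 1) Q"
      by (simp add: aggregate_def Q_def push_def)
    have last: "length (Q ! (L - 1)) = l" using IH(2)[of "L - 1"] L by simp
    have zero: "length (aggregate L l (r # rows) ! 0) = l"
      "i < l \<Longrightarrow> aggregate L l (r # rows) ! 0 ! i = fadd (Q ! (L - 1) ! i) (r ! i)" for i
      using last r(1) by (simp_all add: agg)
    have pos: "aggregate L l (r # rows) ! j = Q ! (j - 1)" if "0 < j" "j < L" for j
      using that by (simp add: agg nth_Cons')
    have "length (aggregate L l (r # rows)) = L" using L IH(1) by (simp add: agg)
    moreover have "length (aggregate L l (r # rows) ! j) = l" if "j < L" for j
      using that zero(1) pos[of j] IH(2)[of "j - 1"] by (cases "j = 0") simp_all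
    moreover have "is_frac (aggregate L l (r # rows) ! j ! i) \<and>
        frac_val (aggregate L l (r # rows) ! j ! i) =
        mod_sum L (length (r # rows)) j (\<lambda>k. frac_val ((r # rows) ! k ! i))"
      if "j < L" "i < l" for i j
    proof (cases "j = 0")
      case True
      have "L - 1 < L" using L by simp
      from IH(3,4)[OF this that(2)] frac_val_fadd[OF IH(3)[OF this that(2)] r(2)[OF that(2)]]
      show ?thesis using that by (simp add: True zero(2) mod_sum_Suc del: One_nat_def)
    next
      case False
      then have "j - 1 < L" "0 < j" using that by simp_all
      from IH(3,4)[OF this(1) that(2)] pos[OF this(2) that(1)]
      show ?thesis using that False by (simp add: mod_sum_Suc del: One_nat_def)
    qed
    ultimately show ?case by blast
  qed
  show "length (aggregate L l rows) = L" using * by blast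
  show "j < L \<Longrightarrow> length (aggregate L l rows ! j) = l" using * by blast
  show "j < L \<Longrightarrow> i < l \<Longrightarrow> is_frac (aggregate L l rows ! j ! i) \<and>
      frac_val (aggregate L l rows ! j ! i) = mod_sum L (length rows) j (\<lambda>k. frac_val (rows ! k ! i))"
    using * by blast
qed

section \<open>The aggregated instance\<close>

lemma mod_sum_cong:
  "(\<And>k. k < K \<Longrightarrow> g k = h k) \<Longrightarrow> mod_sum L K j g = mod_sum L K j h"
  unfolding mod_sum_def by (rule sum.cong) auto

lemma mod_sum_linear:
  fixes g :: "'b \<Rightarrow> nat \<Rightarrow> real"
  shows "(\<Sum>i\<in>I. mod_sum L K j (g i) * h i) = mod_sum L K j (\<lambda>k. \<Sum>i\<in>I. g i k * h i)"
proof -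
  have "(\<Sum>i\<in>I. mod_sum L K j (g i) * h i)
      = (\<Sum>k<K. \<Sum>i\<in>I. (if k mod L = j then g i k else 0) * h i)"
    unfolding mod_sum_def sum_distrib_right by (rule sum.swap)
  also have "\<dots> = mod_sum L K j (\<lambda>k. \<Sum>i\<in>I. g i k * h i)"
    unfolding mod_sum_def by (rule sum.cong) auto
  finally show ?thesis .
qed

text \<open>Subtracting \<open>j - i\<close> maps the class of \<open>j\<close> injectively into the
  class of \<open>i\<close>. It lowers indices, so it does not decrease values of \<open>g\<close>;
  the remaining members of the class of \<open>i\<close> contribute nonnegatively.\<close>

lemma mod_sum_decreasing:
  fixes g :: "nat \<Rightarrow> real"
  assumes ij: "i \<le> j" "j < L" and nonneg: "\<And>k. k < K \<Longrightarrow> 0 \<le> g k"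
    and anti: "\<And>k l. k \<le> l \<Longrightarrow> l < K \<Longrightarrow> g l \<le> g k"
  shows "mod_sum L K j g \<le> mod_sum L K i g"
proof -
  define cls where "cls j = {k \<in> {..<K}. k mod L = j}" for j
  have cls: "mod_sum L K j g = sum g (cls j)" for j
    unfolding mod_sum_def cls_def by (simp only: sum.inter_filter finite_lessThan)
  define d where "d = j - i"
  \<comment> \<open>This keeps the truncated subtraction of \<open>d\<close> injective on the
    class.\<close>
  have ge: "d \<le> k" if "k \<in> cls j" for k
    using that mod_less_eq_dividend[of k L] by (auto simp: cls_def d_def)
  have "(k - d) mod L = i" if "k \<in> cls j" for k
  proof -
    have "k = k div L * L + j" using that by (auto simp: cls_def)
    then have "k - d = k div L * L + i" using ij(1) unfolding d_def by linarith
    then show ?thesis using ij by simp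
  qed
  then have im: "(\<lambda>k. k - d) ` cls j \<subseteq> cls i" by (auto simp: cls_def)
  have "sum g (cls j) \<le> (\<Sum>k\<in>cls j. g (k - d))"
    by (intro sum_mono anti) (auto simp: cls_def)
  also have "\<dots> = sum g ((\<lambda>k. k - d) ` cls j)"
    using ge by (subst sum.reindex) (auto simp: inj_on_def dest: eq_diff_iff)
  also have "\<dots> \<le> sum g (cls i)"
    using im by (rule sum_mono2[rotated]) (auto simp: cls_def nonneg)
  finally show ?thesis unfolding cls .
qed

lemma frac_val_nonneg: "0 \<le> frac_val r"
  by (simp add: frac_val_def)

lemma linear_cost_nonneg: "0 \<le> linear_cost c x"
  unfolding linear_cost_def by (intro sum_nonneg mult_nonneg_nonneg) (auto simp: frac_val_nonneg)

lemma objective_nonneg: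
  assumes "length w = length C"
  shows "0 \<le> objective C w x"
proof -
  have "\<forall>r\<in>set (map (\<lambda>c. linear_cost c x) C). 0 \<le> r" using linear_cost_nonneg by auto
  from decreasing_nonneg[OF this] show ?thesis
    unfolding objective_def owa_eq_decreasing using assms
    by (intro sum_nonneg mult_nonneg_nonneg) (auto simp: frac_val_nonneg)
qed

section \<open>Weights, costs and objective of the aggregated instance\<close>

context
  fixes L n :: nat and C :: "frac list list" and w :: "frac list"
  assumes L: "0 < L" and C: "cost_vectors n C" and w: "nonincreasing_weights (length C) w"
begin

definition "agg = aggregate L (Suc n) (map2 (#) w C)"

private lemma len: "length w = length C"
  using w by (simp add: nonincreasing_weights_def)

private lemma rows: "\<forall>r\<in>set (map2 (#) w C). length r = Suc n \<and> (\<forall>q\<in>set r. is_frac q)"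
proof
  fix r assume "r \<in> set (map2 (#) w C)"
  then obtain q c where r: "r = q # c" and "(q, c) \<in> set (zip w C)" by auto
  then have "q \<in> set w" "c \<in> set C" by (auto dest: set_zip_leftD set_zip_rightD)
  then show "length r = Suc n \<and> (\<forall>q\<in>set r. is_frac q)"
    using C w by (auto simp: r cost_vectors_def nonincreasing_weights_def)
qed

private lemmas agg = aggregate_values[OF L rows, folded agg_def]

private lemma agg_weight:
  assumes "j < L"
  shows "frac_val (map hd agg ! j) = mod_sum L (length C) j (\<lambda>k. frac_val (w ! k))"
proof -
  have "map hd agg ! j = agg ! j ! 0"
    using assms agg(1) agg(2)[OF assms] by (simp add: hd_conv_nth flip: length_greater_0_conv)
  moreover have "mod_sum L (length C) j (\<lambda>k. frac_val (map2 (#) w C ! k ! 0))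
      = mod_sum L (length C) j (\<lambda>k. frac_val (w ! k))"
    by (rule mod_sum_cong) (simp add: len)
  ultimately show ?thesis using agg(3)[OF assms, of 0] by (simp add: len)
qed

private lemma agg_linear_cost:
  assumes "j < L" "length x = n"
  shows "linear_cost (map tl agg ! j) x = mod_sum L (length C) j (\<lambda>k. linear_cost (C ! k) x)"
proof -
  have "frac_val (map tl agg ! j ! i) = mod_sum L (length C) j (\<lambda>k. frac_val (C ! k ! i))"
    if "i < n" for i
  proof -
    have "map tl agg ! j ! i = agg ! j ! Suc i"
      using assms(1) that agg(1) agg(2)[OF assms(1)] by (simp add: nth_tl)
    moreover have "mod_sum L (length C) j (\<lambda>k. frac_val (map2 (#) w C ! k ! Suc i))
        = mod_sum L (length C) j (\<lambda>k. frac_val (C ! k ! i))"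
      by (rule mod_sum_cong) (simp add: len)
    ultimately show ?thesis using agg(3)[OF assms(1), of "Suc i"] that by (simp add: len)
  qed
  then have "linear_cost (map tl agg ! j) x
      = (\<Sum>i<n. mod_sum L (length C) j (\<lambda>k. frac_val (C ! k ! i)) * real (x ! i))"
    unfolding linear_cost_def assms(2) by (intro sum.cong) auto
  then show ?thesis unfolding mod_sum_linear linear_cost_def assms(2) .
qed

lemma cost_vectors_agg: "cost_vectors n (map tl agg)"
  unfolding cost_vectors_def
proof
  fix c assume "c \<in> set (map tl agg)"
  then obtain j where j: "j < L" "c = tl (agg ! j)" using agg(1) by (auto simp: in_set_conv_nth)
  have "is_frac r" if "r \<in> set c" for r
  proof -
    have "r \<in> set (agg ! j)" using that agg(2)[OF j(1)] unfolding j(2) by (cases "agg ! j") auto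
    then show ?thesis using agg(2,3)[OF j(1)] by (auto simp: in_set_conv_nth)
  qed
  then show "length c = n \<and> (\<forall>r\<in>set c. is_frac r)" using agg(2)[OF j(1)] j(2) by simp
qed

private lemma w_props:
  "k < length C \<Longrightarrow> 0 \<le> frac_val (w ! k)"
  "k \<le> l \<Longrightarrow> l < length C \<Longrightarrow> frac_val (w ! l) \<le> frac_val (w ! k)"
  "(\<Sum>k<length C. frac_val (w ! k)) = 1"
  using w by (simp_all add: nonincreasing_weights_def frac_val_nonneg)

text \<open>The total stays 1 by \<open>sum_mod_sum\<close> with \<open>h\<close> constantly 1. As
  the aggregated weights are nonnegative, each of them is then at most 1; monotonicity is
  \<open>mod_sum_decreasing\<close>.\<close>

lemma nonincreasing_weights_agg: "nonincreasing_weights L (map hd agg)"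
proof -
  have total: "(\<Sum>j<L. frac_val (map hd agg ! j)) = 1"
  proof -
    have "(\<Sum>j<L. frac_val (map hd agg ! j))
        = (\<Sum>j<L. mod_sum L (length C) j (\<lambda>k. frac_val (w ! k)) * 1)"
      by (intro sum.cong) (auto simp: agg_weight)
    then show ?thesis unfolding sum_mod_sum[OF L] using w_props(3) by simp
  qed
  have frac: "is_frac (map hd agg ! j) \<and> frac_val (map hd agg ! j) \<in> {0..1}" if "j < L" for j
  proof -
    have "map hd agg ! j = agg ! j ! 0"
      using that agg(1) agg(2)[OF that] by (simp add: hd_conv_nth flip: length_greater_0_conv)
    then have "is_frac (map hd agg ! j)" using agg(3)[OF that, of 0] by simp
    moreover have "frac_val (map hd agg ! j) \<le> (\<Sum>j<L. frac_val (map hd agg ! j))"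
      by (rule member_le_sum) (use that frac_val_nonneg in auto)
    ultimately show ?thesis using total frac_val_nonneg by simp
  qed
  have "\<forall>r\<in>set (map hd agg). is_frac r \<and> frac_val r \<in> {0..1}"
  proof
    fix r assume "r \<in> set (map hd agg)"
    then obtain j where "j < L" "r = map hd agg ! j"
      using agg(1) by (metis in_set_conv_nth length_map)
    then show "is_frac r \<and> frac_val r \<in> {0..1}" using frac by blast
  qed
  moreover have "frac_val (map hd agg ! j) \<le> frac_val (map hd agg ! i)" if "i \<le> j" "j < L" for i j
    using that agg_weight mod_sum_decreasing[OF that w_props(1,2)] by simp
  ultimately show ?thesis
    unfolding nonincreasing_weights_def using total agg(1) by simp
qed

text \<open>For fixed \<open>x\<close> the cost is linear in the cost vector, so aggregating vectors
  aggregates objective values and \<open>owa_round_robin\<close> applies.\<close>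

lemma objective_agg:
  assumes x: "length x = n"
  defines "obj \<equiv> objective C w x" and "obj' \<equiv> objective (map tl agg) (map hd agg) x"
  shows "obj \<le> obj'"
    and "length C \<le> L \<Longrightarrow> obj' \<le> obj"
    and "L < length C \<Longrightarrow> obj' \<le> 2 * real (Suc (length C div L)) * obj"
proof -
  let ?f = "map (\<lambda>c. linear_cost c x) C" and ?w = "map frac_val w"
  let ?a = "map (\<lambda>c. linear_cost c x) (map tl agg)" and ?v = "map frac_val (map hd agg)"
  have a: "?a ! j = mod_sum L (length ?f) j ((!) ?f)" if "j < L" for j
  proof -
    have "?a ! j = linear_cost (map tl agg ! j) x" using that agg(1) by simp
    also have "\<dots> = mod_sum L (length C) j (\<lambda>k. linear_cost (C ! k) x)"
      by (rule agg_linear_cost[OF that x])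
    also have "\<dots> = mod_sum L (length ?f) j ((!) ?f)"
      unfolding length_map by (rule mod_sum_cong) simp
    finally show ?thesis .
  qed
  have v: "?v ! j = mod_sum L (length ?f) j ((!) ?w)" if "j < L" for j
  proof -
    have "?v ! j = frac_val (map hd agg ! j)" using that agg(1) by simp
    also have "\<dots> = mod_sum L (length C) j (\<lambda>k. frac_val (w ! k))" by (rule agg_weight[OF that])
    also have "\<dots> = mod_sum L (length ?f) j ((!) ?w)"
      unfolding length_map by (rule mod_sum_cong) (simp add: len)
    finally show ?thesis .
  qed
  have lens: "length ?w = length ?f" "length ?a = L" "length ?v = L" using len agg(1) by simp_all
  have f: "0 \<le> ?f ! i" if "i < length ?f" for i using that linear_cost_nonneg by simp
  have u: "0 \<le> ?w ! i" if "i < length ?f" for i using that len frac_val_nonneg by simp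
  have u': "?w ! j \<le> ?w ! i" if "i \<le> j" "j < length ?f" for i j
    using that w_props(2)[of i j] len by simp
  note rr = owa_round_robin[OF L lens f u u' a v]
  show "obj \<le> obj'" unfolding obj_def obj'_def objective_def by (rule rr(1))
  show "obj' \<le> obj" if "length C \<le> L"
    unfolding obj_def obj'_def objective_def using that by (intro rr(2)) simp_all
  show "obj' \<le> 2 * real (Suc (length C div L)) * obj" if "L < length C"
    using rr(3) that unfolding obj_def obj'_def objective_def by simp
qed

end

section \<open>Polynomial time bounds and the approximation ratio\<close>

definition polynomial_function :: "(nat \<Rightarrow> nat) \<Rightarrow> bool" where
  "polynomial_function f \<longleftrightarrow> (\<exists>p. \<forall>x. f x = poly p x)"

lemma polynomial_function_const: "polynomial_function (\<lambda>_. c)"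
  unfolding polynomial_function_def by (intro exI[of _ "[:c:]"]) simp

lemma polynomial_function_id: "polynomial_function (\<lambda>x. x)"
  unfolding polynomial_function_def by (intro exI[of _ "[:0, 1:]"]) simp

lemma polynomial_function_add:
  "polynomial_function f \<Longrightarrow> polynomial_function g \<Longrightarrow> polynomial_function (\<lambda>x. f x + g x)"
  unfolding polynomial_function_def by (metis poly_add)

lemma polynomial_function_mult:
  "polynomial_function f \<Longrightarrow> polynomial_function g \<Longrightarrow> polynomial_function (\<lambda>x. f x * g x)"
  unfolding polynomial_function_def by (metis poly_mult)

lemma polynomial_function_poly:
  "polynomial_function f \<Longrightarrow> polynomial_function (\<lambda>x. poly p (f x))"
  unfolding polynomial_function_def by (metis poly_pcompose)

lemmas polynomial_function_intros = polynomial_function_const polynomial_function_id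
  polynomial_function_add polynomial_function_mult polynomial_function_poly

lemma polynomial_function_size_bound: "polynomial_function (size_bound L)"
  unfolding size_bound_def row_bound_def by (intro polynomial_function_intros)

lemma polynomial_function_aggregate_time:
  "polynomial_function (\<lambda>N. aggregate_time L (size_bound L N) N N)"
  unfolding aggregate_time_def push_time_def Suc_eq_plus1
  by (intro polynomial_function_intros polynomial_function_size_bound)

text \<open>Since coefficients are natural numbers, the time bound of the given algorithm may be
  evaluated at an upper bound for the size of the aggregated instance.\<close>

lemma poly_nat_mono: "x \<le> y \<Longrightarrow> poly p x \<le> poly p (y :: nat)"
  by (induction p) (auto intro: add_left_mono mult_mono)

lemma finite_feasible:
  assumes "combinatorial_problem P" "P d = Some (n, X)"
  shows "finite X" "x \<in> X \<Longrightarrow> length x = n"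
proof -
  have sub: "X \<subseteq> {x. length x = n \<and> set x \<subseteq> {0, 1}}"
    using assms unfolding combinatorial_problem_def by blast
  moreover have "finite {x. set x \<subseteq> {0, 1 :: nat} \<and> length x = n}"
    by (rule finite_lists_length_eq) simp
  ultimately show "finite X" by (simp add: conj_commute finite_subset)
  show "x \<in> X \<Longrightarrow> length x = n" using sub by blast
qed

text \<open>By \<open>no_epsK_approximation_for_small_K\<close> the ratio
  \<open>\<epsilon> * real K\<close> alone cannot be guaranteed for small \<open>K\<close>; the
  maximum with 2 equals it as soon as \<open>K \<ge> 2 / \<epsilon>\<close>.\<close>

theorem theorem2:
  fixes P :: problem
  assumes "combinatorial_problem P"
    and "\<And>K. K \<ge> 1 \<Longrightarrow> owa_approximable P {K} (\<lambda>_. 2)"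
  shows "\<forall>\<epsilon>::real. \<epsilon> > 0 \<longrightarrow> owa_approximable P {1..} (\<lambda>K. max 2 (\<epsilon> * real K))"
proof (intro allI impI)
  fix \<epsilon> :: real assume \<epsilon>: "\<epsilon> > 0"
  \<comment> \<open>The 8 is the product of the given ratio 2, the factor 2 in
    \<open>objective_agg\<close> and the factor 2 in \<open>Suc (K div L) \<le> 2 * K / L\<close>,
    which holds for \<open>K > L\<close>.\<close>
  define L where "L = Suc (nat \<lceil>8 / \<epsilon>\<rceil>)"
  have L: "0 < L" "8 / \<epsilon> \<le> real L" unfolding L_def by (simp, linarith)
  obtain alg p where alg: "\<And>d n X K C w. P d = Some (n, X) \<and> K \<in> {L} \<and> length C = K \<and>
      cost_vectors n C \<and> nonincreasing_weights K w \<Longrightarrow>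
      \<exists>t v. computes alg (enc_instance d C w) t v \<and> t \<le> poly p (bits (enc_instance d C w)) \<and>
        (X \<noteq> {} \<longrightarrow> (\<exists>x\<in>X. v = enc_list Num x \<and>
          objective C w x \<le> 2 * (MIN y\<in>X. objective C w y)))"
    using assms(2)[of L] L(1) unfolding owa_approximable_def by auto
  define T where "T N = aggregate_time L (size_bound L N) N N
    + poly p (block_growth (out_body L) * size_bound L N)" for N
  have "polynomial_function T"
    unfolding T_def by (intro polynomial_function_intros polynomial_function_size_bound
      polynomial_function_aggregate_time)
  then obtain q where q: "\<And>N. T N = poly q N" unfolding polynomial_function_def by blast
  show "owa_approximable P {1..} (\<lambda>K. max 2 (\<epsilon> * real K))"
    unfolding owa_approximable_def
  proof (intro exI[of _ "Seq (aggregate_com L) alg"] exI[of _ q] allI impI, elim conjE)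
    fix d n X K C w
    assume P: "P d = Some (n, X)" and K: "K \<in> {1..}" "length C = K"
      and C: "cost_vectors n C" and "nonincreasing_weights K w"
    then have w: "nonincreasing_weights (length C) w" by simp
    define N where "N = bits (enc_instance d C w)"
    define Q where "Q = agg L n C w"
    define inst where "inst = enc_instance d (map tl Q) (map hd Q)"
    have Q: "cost_vectors n (map tl Q)" "nonincreasing_weights L (map hd Q)"
      unfolding Q_def using cost_vectors_agg[OF L(1) C w] nonincreasing_weights_agg[OF L(1) C w] .
    have lens: "C \<noteq> []" "length w = length C" "\<forall>c\<in>set C. length c = n" "length Q = L"
      using K C w Q(2) by (auto simp: cost_vectors_def nonincreasing_weights_def)
    have run: "runs (aggregate_com L) ((\<lambda>_. Num 0)(0 := enc_instance d C w))
        (aggregate_time L (size_bound L N) N N) ((\<lambda>_. Num 0)(0 := inst))"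
      and size: "bits inst \<le> block_growth (out_body L) * size_bound L N"
      using runs_aggregate_poly[OF L(1) lens(1-3), of d]
      unfolding N_def inst_def Q_def agg_def[OF L(1) C w] by blast+
    obtain t v where t: "computes alg inst t v" "t \<le> poly p (bits inst)"
      and v: "X \<noteq> {} \<Longrightarrow> \<exists>x\<in>X. v = enc_list Num x \<and>
          objective (map tl Q) (map hd Q) x \<le> 2 * (MIN y\<in>X. objective (map tl Q) (map hd Q) y)"
      using alg[of d n X L "map tl Q" "map hd Q"] P Q lens(4) unfolding inst_def by auto
    obtain t' where t': "t' \<le> aggregate_time L (size_bound L N) N N"
        "exec (aggregate_com L) ((\<lambda>_. Num 0)(0 := enc_instance d C w)) t' ((\<lambda>_. Num 0)(0 := inst))"
      using run unfolding runs_def by blast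
    have comp: "computes (Seq (aggregate_com L) alg) (enc_instance d C w) (t' + t) v"
      using t(1) exec.Seq[OF t'(2)] unfolding computes_def by blast
    have "t \<le> poly p (block_growth (out_body L) * size_bound L N)"
      using t(2) poly_nat_mono[OF size, of p] by linarith
    then have time: "t' + t \<le> poly q N" using t'(1) unfolding q[symmetric] T_def by linarith
    have ratio: "\<exists>x\<in>X. v = enc_list Num x \<and>
        objective C w x \<le> max 2 (\<epsilon> * real K) * (MIN y\<in>X. objective C w y)" if ne: "X \<noteq> {}"
    proof -
      note fin = finite_feasible[OF assms(1) P]
      note obj = objective_agg[OF L(1) C w, folded Q_def]
      obtain x where x: "x \<in> X" "v = enc_list Num x"
        "objective (map tl Q) (map hd Q) x \<le> 2 * (MIN y\<in>X. objective (map tl Q) (map hd Q) y)"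
        using v[OF ne] by blast
      have "(MIN y\<in>X. objective C w y) \<in> objective C w ` X" using fin(1) ne by (intro Min_in) auto
      then obtain y where y: "y \<in> X" "(MIN y\<in>X. objective C w y) = objective C w y" by blast
      have nonneg: "0 \<le> objective C w y" by (rule objective_nonneg[OF lens(2)])
      \<comment> \<open>An optimal \<open>y\<close> of the original instance bounds the aggregated
        optimum, so the aggregated objective has to be bounded from above at \<open>y\<close>
        only.\<close>
      have "(MIN y\<in>X. objective (map tl Q) (map hd Q) y) \<le> objective (map tl Q) (map hd Q) y"
        using fin(1) y(1) by (intro Min_le) auto
      then have le: "objective C w x \<le> 2 * objective (map tl Q) (map hd Q) y"
        using x(3) obj(1)[OF fin(2)[OF x(1)]] by linarith
      have "objective C w x \<le> max 2 (\<epsilon> * real K) * objective C w y"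
      proof (cases "K \<le> L")
        case True
        then have "objective C w x \<le> 2 * objective C w y"
          using le obj(2)[OF fin(2)[OF y(1)]] K(2) by simp
        also have "\<dots> \<le> max 2 (\<epsilon> * real K) * objective C w y"
          using nonneg by (intro mult_right_mono) simp_all
        finally show ?thesis .
      next
        case False
        then have "objective (map tl Q) (map hd Q) y \<le> 2 * real (Suc (K div L)) * objective C w y"
          using obj(3)[OF fin(2)[OF y(1)]] K(2) by simp
        then have "objective C w x \<le> 4 * real (Suc (K div L)) * objective C w y"
          using le by (simp add: algebra_simps)
        also have "\<dots> \<le> max 2 (\<epsilon> * real K) * objective C w y"
        proof (rule mult_right_mono[OF _ nonneg])
          have "real (K div L) \<le> real K / real L" by (rule of_nat_div_le_of_nat)
          \<comment> \<open>This absorbs the successor in \<open>Suc (K div L)\<close>.\<close>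
          moreover have "1 \<le> real K / real L" using False L(1) by simp
          ultimately have "4 * real (Suc (K div L)) \<le> 8 / real L * real K" by simp
          also have "\<dots> \<le> \<epsilon> * real K"
            using L \<epsilon> by (intro mult_right_mono) (auto simp: field_simps)
          finally show "4 * real (Suc (K div L)) \<le> max 2 (\<epsilon> * real K)" by simp
        qed
        finally show ?thesis .
      qed
      then show ?thesis using x(1,2) y(2) by auto
    qed
    show "\<exists>t v. computes (Seq (aggregate_com L) alg) (enc_instance d C w) t v \<and>
        t \<le> poly q (bits (enc_instance d C w)) \<and>
        (X \<noteq> {} \<longrightarrow> (\<exists>x\<in>X. v = enc_list Num x \<and>
          objective C w x \<le> max 2 (\<epsilon> * real K) * (MIN y\<in>X. objective C w y)))"
      using comp time[unfolded N_def] ratio by blast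
  qed
qed

end
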